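(* For a clause-set $F$ all of whose clauses have at most two literals, it can be decided in linear time whether $F$ is minimally unsatisfiable.
   Context: Literals are variables and their complements; a clause is a finite set of literals without complementary pair; a clause-set is a finite set of clauses. A clause-set is satisfied by a partial assignment if every clause contains a literal set to true. $F$ is minimally unsatisfiable if $F$ is unsatisfiable but $F\setminus\{C\}$ is satisfiable for every $C\in F$. *)

theory Defs
  imports Main
begin

section \<open>Clause-sets and minimal unsatisfiability\<close>

datatype 'v literal = Pos 'v | Neg 'v

fun compl :: "'v literal \<Rightarrow> 'v literal" where
  "compl (Pos v) = Neg v"
| "compl (Neg v) = Pos v"

type_synonym 'v clause = "'v literal set"

definition is_clause :: "'v clause \<Rightarrow> bool" where
  "is_clause C \<longleftrightarrow> finite C \<and> (\<forall>l\<in>C. compl l \<notin> C)"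

definition clause_set :: "'v clause set \<Rightarrow> bool" where
  "clause_set F \<longleftrightarrow> finite F \<and> (\<forall>C\<in>F. is_clause C)"

fun lit_true :: "('v \<rightharpoonup> bool) \<Rightarrow> 'v literal \<Rightarrow> bool" where
  "lit_true \<phi> (Pos v) \<longleftrightarrow> \<phi> v = Some True"
| "lit_true \<phi> (Neg v) \<longleftrightarrow> \<phi> v = Some False"

definition satisfies :: "('v \<rightharpoonup> bool) \<Rightarrow> 'v clause set \<Rightarrow> bool" where
  "satisfies \<phi> F \<longleftrightarrow> (\<forall>C\<in>F. \<exists>l\<in>C. lit_true \<phi> l)"

definition satisfiable :: "'v clause set \<Rightarrow> bool" where
  "satisfiable F \<longleftrightarrow> (\<exists>\<phi>. satisfies \<phi> F)"

definition minimally_unsat :: "'v clause set \<Rightarrow> bool" where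
  "minimally_unsat F \<longleftrightarrow> \<not> satisfiable F \<and> (\<forall>C\<in>F. satisfiable (F - {C}))"

section \<open>Random access machines\<close>

text \<open>
  The model of computation is a random access machine, programmed in a structured language.
  A state has integer registers and integer arrays.  A program is a finite term, so it mentions
  only finitely many registers and arrays; keeping several arrays in place of one
  memory, and allowing negative array indices, only saves the interleaving of finitely many
  one-sided memories.  Every elementary operation costs one unit.

  The only arithmetic is negation and the addition of a constant.  So in \<open>t\<close> steps a
  given program can only produce numbers whose absolute value exceeds that of the input by
  \<open>O(t)\<close>: the unit-cost measure cannot be exploited by computing with very long words.
\<close>

datatype aexp =
    Const int
  | Reg nat
  | Load nat aexp      \<comment> \<open>\<open>Load a i\<close> reads array \<open>a\<close> at index \<open>i\<close>\<close>
  | AddC aexp int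
  | Minus aexp

datatype bexp =
    Eq aexp aexp
  | Less aexp aexp
  | Not bexp
  | And bexp bexp

datatype com =
    Skip
  | Assign nat aexp
  | Store nat aexp aexp  \<comment> \<open>\<open>Store a i e\<close> writes \<open>e\<close> to array \<open>a\<close> at index \<open>i\<close>\<close>
  | Seq com com
  | If bexp com com
  | While bexp com

record state =
  regs :: "nat \<Rightarrow> int"
  arrs :: "nat \<Rightarrow> int \<Rightarrow> int"

fun aval :: "aexp \<Rightarrow> state \<Rightarrow> int" where
  "aval (Const k) s = k"
| "aval (Reg x) s = regs s x"
| "aval (Load a i) s = arrs s a (aval i s)"
| "aval (AddC e k) s = aval e s + k"
| "aval (Minus e) s = - aval e s"

fun acost :: "aexp \<Rightarrow> nat" where
  "acost (Const k) = 1"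
| "acost (Reg x) = 1"
| "acost (Load a i) = acost i + 1"
| "acost (AddC e k) = acost e + 1"
| "acost (Minus e) = acost e + 1"

fun bval :: "bexp \<Rightarrow> state \<Rightarrow> bool" where
  "bval (Eq e1 e2) s \<longleftrightarrow> aval e1 s = aval e2 s"
| "bval (Less e1 e2) s \<longleftrightarrow> aval e1 s < aval e2 s"
| "bval (Not b) s \<longleftrightarrow> \<not> bval b s"
| "bval (And b1 b2) s \<longleftrightarrow> bval b1 s \<and> bval b2 s"

fun bcost :: "bexp \<Rightarrow> nat" where
  "bcost (Eq e1 e2) = acost e1 + acost e2 + 1"
| "bcost (Less e1 e2) = acost e1 + acost e2 + 1"
| "bcost (Not b) = bcost b + 1"
| "bcost (And b1 b2) = bcost b1 + bcost b2 + 1"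

text \<open>\<open>exec c s t s'\<close>: started in state \<open>s\<close>, program \<open>c\<close> halts in state \<open>s'\<close> after \<open>t\<close> steps.\<close>

inductive exec :: "com \<Rightarrow> state \<Rightarrow> nat \<Rightarrow> state \<Rightarrow> bool" where
  Skip: "exec Skip s 1 s"
| Assign: "exec (Assign x e) s (acost e + 1) (s\<lparr>regs := (regs s)(x := aval e s)\<rparr>)"
| Store: "exec (Store a i e) s (acost i + acost e + 1)
    (s\<lparr>arrs := (arrs s)(a := (arrs s a)(aval i s := aval e s))\<rparr>)"
| Seq: "exec c1 s t1 s' \<Longrightarrow> exec c2 s' t2 s'' \<Longrightarrow> exec (Seq c1 c2) s (t1 + t2) s''"
| IfTrue: "bval b s \<Longrightarrow> exec c1 s t s' \<Longrightarrow> exec (If b c1 c2) s (bcost b + t + 1) s'"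
| IfFalse: "\<not> bval b s \<Longrightarrow> exec c2 s t s' \<Longrightarrow> exec (If b c1 c2) s (bcost b + t + 1) s'"
| WhileFalse: "\<not> bval b s \<Longrightarrow> exec (While b c) s (bcost b + 1) s"
| WhileTrue: "bval b s \<Longrightarrow> exec c s t1 s' \<Longrightarrow> exec (While b c) s' t2 s'' \<Longrightarrow>
    exec (While b c) s (bcost b + 1 + t1 + t2) s''"

inductive_cases exec_SkipE: "exec Skip s t s'"
inductive_cases exec_AssignE: "exec (Assign x e) s t s'"
inductive_cases exec_StoreE: "exec (Store a i e) s t s'"
inductive_cases exec_SeqE: "exec (Seq c1 c2) s t s'"
inductive_cases exec_IfE: "exec (If b c1 c2) s t s'"
inductive_cases exec_WhileE: "exec (While b c) s t s'"

lemma exec_deterministic: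
  "exec c s t s' \<Longrightarrow> exec c s u s'' \<Longrightarrow> u = t \<and> s'' = s'"
proof (induction arbitrary: u s'' rule: exec.induct)
  case (Skip s)
  from Skip.prems show ?case by (rule exec_SkipE) simp
next
  case (Assign x e s)
  from Assign.prems show ?case by (rule exec_AssignE) simp
next
  case (Store a i e s)
  from Store.prems show ?case by (rule exec_StoreE) simp
next
  case (Seq c1 s t1 s' c2 t2 s2)
  from Seq.prems show ?case by (rule exec_SeqE) (metis Seq.IH)
next
  case (IfTrue b s c1 t s' c2)
  from IfTrue.prems show ?case by (rule exec_IfE) (use IfTrue.hyps(1) IfTrue.IH in auto)
next
  case (IfFalse b s c2 t s' c1)
  from IfFalse.prems show ?case by (rule exec_IfE) (use IfFalse.hyps(1) IfFalse.IH in auto)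
next
  case (WhileFalse b s c)
  from WhileFalse.prems show ?case by (rule exec_WhileE) (use WhileFalse.hyps in simp_all)
next
  case (WhileTrue b s c t1 s' t2 s2)
  from WhileTrue.prems show ?case
    by (rule exec_WhileE) (use WhileTrue.hyps(1) in simp, use WhileTrue.IH in fastforce)
qed

text \<open>
  The input word is in array 0 and its length in register 0; everything else is zero.
  The answer is returned in register 0.
\<close>

definition init_state :: "int list \<Rightarrow> state" where
  "init_state w =
    \<lparr>regs = (\<lambda>x. if x = 0 then int (length w) else 0),
     arrs = (\<lambda>a i. if a = 0 \<and> 0 \<le> i \<and> i < int (length w) then w ! nat i else 0)\<rparr>"

text \<open>
  An object \<open>X\<close> may be presented to the machine by any word \<open>w\<close> with \<open>enc X w\<close>.  On the domain
  \<open>D\<close>, and for every such presentation, one fixed program has to halt with the answer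
  to \<open>P X\<close> within a number of steps linear in the length of \<open>w\<close>.
\<close>

definition decidable_in_linear_time ::
    "('a \<Rightarrow> int list \<Rightarrow> bool) \<Rightarrow> 'a set \<Rightarrow> ('a \<Rightarrow> bool) \<Rightarrow> bool" where
  "decidable_in_linear_time enc D P \<longleftrightarrow>
    (\<exists>prog (c::nat). \<forall>X\<in>D. \<forall>w. enc X w \<longrightarrow>
      (\<exists>t s. exec prog (init_state w) t s \<and> t \<le> c * (length w + 1) \<and>
        regs s 0 = (if P X then 1 else 0)))"

section \<open>Clause-sets as machine inputs\<close>

text \<open>
  Variables are natural numbers.  As in the DIMACS format, a literal is a nonzero integer,
  complementation is negation, and every clause is terminated by \<open>0\<close>.
  Clauses, and the literals in a clause, are listed in any order but without
  repetition, so the length of an encoding of \<open>F\<close> is the number of literal occurrences of \<open>F\<close> plus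
  the number of clauses of \<open>F\<close>.  The size of the variable names does not enter.
\<close>

fun lit_code :: "nat literal \<Rightarrow> int" where
  "lit_code (Pos v) = int v + 1"
| "lit_code (Neg v) = - (int v + 1)"

definition encodes :: "nat clause set \<Rightarrow> int list \<Rightarrow> bool" where
  "encodes F w \<longleftrightarrow>
    (\<exists>Ls. distinct (map set Ls) \<and> (\<forall>L\<in>set Ls. distinct L) \<and> F = set (map set Ls) \<and>
      w = concat (map (\<lambda>L. map lit_code L @ [0]) Ls))"

lemma encodes_length:
  assumes "encodes F w"
  shows "length w = (\<Sum>C\<in>F. card C + 1)"
proof -
  obtain Ls where Ls: "distinct (map set Ls)" "\<forall>L\<in>set Ls. distinct L" "F = set (map set Ls)"
    and w: "w = concat (map (\<lambda>L. map lit_code L @ [0]) Ls)"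
    using assms unfolding encodes_def by blast
  have "length w = sum_list (map (\<lambda>C. card C + 1) (map set Ls))"
    using Ls(2) unfolding w by (induction Ls) (simp_all add: distinct_card)
  also have "\<dots> = (\<Sum>C\<in>F. card C + 1)"
    unfolding Ls(3) using Ls(1) by (rule sum_list_distinct_conv_sum_set)
  finally show ?thesis .
qed

lemma encodes_exists:
  assumes "clause_set F"
  shows "\<exists>w. encodes F w"
proof -
  obtain Cs where Cs: "set Cs = F" "distinct Cs"
    using assms unfolding clause_set_def by (meson finite_distinct_list)
  have "\<forall>C\<in>F. \<exists>L. set L = C \<and> distinct L"
    using assms unfolding clause_set_def is_clause_def by (meson finite_distinct_list)
  then obtain f where f: "\<forall>C\<in>F. set (f C) = C \<and> distinct (f C)"
    unfolding bchoice_iff by blast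
  have "map set (map f Cs) = Cs" using f Cs(1) by (auto intro!: map_idI)
  then have "encodes F (concat (map (\<lambda>L. map lit_code L @ [0]) (map f Cs)))"
    unfolding encodes_def using Cs f by (intro exI[of _ "map f Cs"]) simp
  then show ?thesis by blast
qed

end

(*
A unit clause {x} is read as {x, x}, so that a clause-set becomes a multigraph on the literals.
If it is minimally unsatisfiable, then following implications from any literal l one reaches the
complement of a literal seen before, and the clauses met on two such walks, from l and from - l,
form an unsatisfiable set and hence are all clauses.  Counting occurrences along the walks shows
that every literal has at most two neighbours.

While some literal l occurs in one clause {l, a} only, - l is replaced by a.  When every literal
occurs twice, the walks from l and - l are forced to pass through every variable and to
return to their start, so that the clauses with the variable of a literal x state its equivalence
to two literals p and q; these four clauses are replaced by the equivalence of p and q.  Both steps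
take constant time and preserve minimal unsatisfiability in both directions, and the
last variable has to be left with {x, x} and {- x, - x}.
*)

theory Submission
  imports Defs "HOL-Library.Multiset" "HOL-Library.Transitive_Closure_Table"
begin

section \<open>Clauses with two literals\<close>

text \<open>The bound two on degrees is what makes linear time possible: the neighbours of a literal
  fit into two array cells, so each replacement takes constant time, and a demand for a third cell
  already refutes minimal unsatisfiability. Walks occur only in the proofs; the machine never
  follows one. It tests what the walks force locally, and since both reductions are equivalences
  also for inputs that are not minimally unsatisfiable, a failed test refutes the original input.

  One sweep over the input word suffices for each reduction: replacing a literal never creates a
  literal of degree one, and eliminating a variable keeps all other degrees. A literal once treated
  needs no second visit.

  Multisets are needed at both levels: a clause {x, x} has to count twice at x, and a replacement
  may produce a second copy of a clause, which minimality must reject. The clause-set {{}} has no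
  form with two literals per clause; its word is the only one of length one and gets a test of its
  own.\<close>

definition asg :: "(int \<Rightarrow> bool) \<Rightarrow> bool" where
  "asg \<phi> \<longleftrightarrow> (\<forall>x. x \<noteq> 0 \<longrightarrow> \<phi> (- x) = (\<not> \<phi> x))"

definition models :: "(int \<Rightarrow> bool) \<Rightarrow> int multiset multiset \<Rightarrow> bool" where
  "models \<phi> M \<longleftrightarrow> (\<forall>C\<in>#M. \<exists>x\<in>#C. \<phi> x)"

definition sat :: "int multiset multiset \<Rightarrow> bool" where
  "sat M \<longleftrightarrow> (\<exists>\<phi>. asg \<phi> \<and> models \<phi> M)"

text \<open>Only one copy of \<open>C\<close> is removed, so a clause with two copies makes
  \<open>M\<close> non-minimal.\<close>

definition mu :: "int multiset multiset \<Rightarrow> bool" where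
  "mu M \<longleftrightarrow> \<not> sat M \<and> (\<forall>C\<in>#M. sat (M - {#C#}))"

definition wf2 :: "int multiset multiset \<Rightarrow> bool" where
  "wf2 M \<longleftrightarrow> (\<forall>C\<in>#M. \<exists>x y. C = {#x, y#} \<and> x \<noteq> 0 \<and> y \<noteq> 0)"

text \<open>A clause \<open>{x, x}\<close> makes \<open>x\<close> a neighbour of itself twice.\<close>

definition nbs :: "int multiset multiset \<Rightarrow> int \<Rightarrow> int multiset" where
  "nbs M z = \<Sum>\<^sub># (image_mset (\<lambda>C. repeat_mset (count C z) (C - {#z#})) M)"

abbreviation deg :: "int multiset multiset \<Rightarrow> int \<Rightarrow> nat" where
  "deg M z \<equiv> size (nbs M z)"

lemma wf2_add [simp]: "wf2 (add_mset {#x, y#} M) \<longleftrightarrow> x \<noteq> 0 \<and> y \<noteq> 0 \<and> wf2 M"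
  by (auto simp: wf2_def add_eq_conv_ex)

lemma wf2_empty [simp]: "wf2 {#}"
  by (simp add: wf2_def)

lemma wf2_union [simp]: "wf2 (M + M') \<longleftrightarrow> wf2 M \<and> wf2 M'"
  by (auto simp: wf2_def)

lemma wf2_subset: "wf2 M \<Longrightarrow> M' \<subseteq># M \<Longrightarrow> wf2 M'"
  by (meson mset_subset_eqD wf2_def)

lemma wf2_nonzero: "wf2 M \<Longrightarrow> C \<in># M \<Longrightarrow> z \<in># C \<Longrightarrow> z \<noteq> 0"
  by (fastforce simp: wf2_def)

lemma nbs_empty [simp]: "nbs {#} z = {#}"
  by (simp add: nbs_def)

lemma nbs_union [simp]: "nbs (M + M') z = nbs M z + nbs M' z"
  by (simp add: nbs_def)

lemma nbs_add [simp]: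
  "nbs (add_mset {#x, y#} M) z =
    (if z = x then {#y#} else {#}) + (if z = y then {#x#} else {#}) + nbs M z"
  by (auto simp: nbs_def numeral_2_eq_2)

lemma nbs_eq_empty_iff: "wf2 M \<Longrightarrow> nbs M z = {#} \<longleftrightarrow> (\<forall>C\<in>#M. z \<notin># C)"
proof (induction M)
  case (add C M)
  then obtain x y where "C = {#x, y#}" by (auto simp: wf2_def)
  with add show ?case by (auto simp: wf2_def)
qed simp

lemma in_nbs_iff: "wf2 M \<Longrightarrow> y \<in># nbs M x \<longleftrightarrow> {#x, y#} \<in># M"
proof (induction M)
  case (add C M)
  then obtain u v where "C = {#u, v#}" by (auto simp: wf2_def)
  with add show ?case by (auto simp: wf2_def add_eq_conv_ex)
qed simp

lemma nbs_obtain: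
  assumes "wf2 M" "y \<in># nbs M x"
  obtains M' where "M = add_mset {#x, y#} M'"
  using assms by (metis in_nbs_iff insert_DiffM)

lemma deg_mono: "M \<subseteq># M' \<Longrightarrow> deg M z \<le> deg M' z"
  by (metis le_add1 nbs_union size_union subset_mset.add_diff_inverse)

lemma asg_minus: "asg \<phi> \<Longrightarrow> x \<noteq> 0 \<Longrightarrow> \<phi> (- x) \<longleftrightarrow> \<not> \<phi> x"
  by (simp add: asg_def)

lemma models_add [simp]: "models \<phi> (add_mset C M) \<longleftrightarrow> (\<exists>x\<in>#C. \<phi> x) \<and> models \<phi> M"
  by (auto simp: models_def)

lemma models_union [simp]: "models \<phi> (M + M') \<longleftrightarrow> models \<phi> M \<and> models \<phi> M'"
  by (auto simp: models_def)

lemma models_empty [simp]: "models \<phi> {#}"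
  by (simp add: models_def)

lemma models_subset: "models \<phi> M \<Longrightarrow> set_mset M' \<subseteq> set_mset M \<Longrightarrow> models \<phi> M'"
  by (auto simp: models_def)

lemma sat_subset: "sat M \<Longrightarrow> set_mset M' \<subseteq> set_mset M \<Longrightarrow> sat M'"
  by (meson models_subset sat_def)

lemma sat_empty: "sat {#}"
  unfolding sat_def asg_def by (intro exI[of _ "\<lambda>x. x > 0"]) auto

text \<open>If \<open>C\<close> were missing from \<open>U\<close>, or had two copies in
  \<open>M\<close>, then \<open>M\<close> without one copy of \<open>C\<close> would still contain
  all of \<open>U\<close>. The hypothesis compares sets and the conclusion multisets; this gain
  yields degree bounds.\<close>

lemma mu_subset_unsat:
  assumes "mu M" "set_mset U \<subseteq> set_mset M" "\<not> sat U"
  shows "M \<subseteq># U"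
proof (rule mset_subset_eqI)
  fix C
  show "count M C \<le> count U C"
  proof (cases "C \<in># M")
    case True
    then have "\<not> set_mset U \<subseteq> set_mset (M - {#C#})"
      using assms sat_subset by (metis mu_def)
    then obtain D where D: "D \<in># U" "D \<notin># M - {#C#}" by auto
    with assms(2) have "D \<in># M" by auto
    with D have "D = C" by (auto simp: in_diff_count count_greater_zero_iff split: if_splits)
    with D have "count M C \<le> 1" "C \<in># U"
      by (auto simp: not_in_iff)
    then show ?thesis
      by (metis One_nat_def Suc_leI count_greater_zero_iff order_trans)
  qed (simp add: not_in_iff)
qed

text \<open>Each clause of \<open>M\<close> taken once is already an unsatisfiable
  collection.\<close>

lemma mu_count: "mu M \<Longrightarrow> count M C \<le> 1"
proof -
  assume "mu M"
  then have sub: "M \<subseteq># mset_set (set_mset M)"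
    by (intro mu_subset_unsat) (auto simp: mu_def dest: sat_subset[where M'=M])
  then show ?thesis
    using mset_subset_eq_count[OF sub, of C] by (auto simp: count_mset_set' split: if_splits)
qed

text \<open>Every assignment makes \<open>x\<close> or \<open>- x\<close> true, so a model of the
  other clauses would be a model of all.\<close>

lemma mu_no_taut:
  assumes "mu M" "wf2 M" shows "{#x, - x#} \<notin># M"
proof
  assume t: "{#x, - x#} \<in># M"
  with assms(1) obtain \<phi> where \<phi>: "asg \<phi>" "models \<phi> (M - {#{#x, - x#}#})"
    unfolding mu_def sat_def by blast
  have "x \<noteq> 0" using t assms(2) wf2_nonzero by fastforce
  then have "models \<phi> (add_mset {#x, - x#} (M - {#{#x, - x#}#}))"
    using \<phi> by (auto simp: asg_def)
  with t \<phi> assms(1) show False unfolding mu_def sat_def by auto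
qed

section \<open>Walks\<close>

text \<open>The implication digraph of a 2-CNF; each clause gives an edge and its
  contrapositive.\<close>

abbreviation edge :: "int multiset multiset \<Rightarrow> int \<Rightarrow> int \<Rightarrow> bool" where
  "edge M x y \<equiv> {#- x, y#} \<in># M"

lemma edge_contra: "edge M x y \<Longrightarrow> edge M (- y) (- x)"
  by (simp add: add_mset_commute)

lemma edges_contra: "(edge M)\<^sup>*\<^sup>* x y \<Longrightarrow> (edge M)\<^sup>*\<^sup>* (- y) (- x)"
proof (induction rule: rtranclp_induct)
  case (step y z)
  then show ?case using edge_contra by (metis (no_types, lifting) converse_rtranclp_into_rtranclp)
qed simp

text \<open>A path through distinct variables whose closing edge runs to the complement of its own
  vertex \<open>y\<close>: the part from \<open>l\<close> to \<open>y\<close> is the stick, the rest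
  the loop. Assuming \<open>l\<close>, it yields both \<open>y\<close> and
  \<open>- y\<close>.\<close>

definition lollipop :: "int multiset multiset \<Rightarrow> int \<Rightarrow> int list \<Rightarrow> int \<Rightarrow> bool" where
  "lollipop M l xs y \<longleftrightarrow> xs \<noteq> [] \<and> hd xs = l \<and> successively (edge M) xs \<and>
     distinct (map abs xs) \<and> y \<in> set xs \<and> edge M (last xs) (- y)"

text \<open>If no complementary pair were reachable from \<open>l\<close>, the reachable literals
  would form an autarky: making them true satisfies every clause that meets their variables, in
  particular \<open>C0\<close>, and leaves the model of the other clauses intact elsewhere. Given a
  reachable pair \<open>y\<close>, \<open>- y\<close>, reversing the path to \<open>- y\<close> by
  contraposition leads from \<open>y\<close> on to \<open>- l\<close>.\<close>

lemma mu_reaches_compl: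
  assumes M: "mu M" "wf2 M" and l: "C0 \<in># M" "l \<in># C0 \<or> - l \<in># C0"
  shows "(edge M)\<^sup>*\<^sup>* l (- l)"
proof -
  let ?R = "\<lambda>y. (edge M)\<^sup>*\<^sup>* l y"
  have "\<exists>y. ?R y \<and> ?R (- y)"
  proof (rule ccontr)
    assume "\<nexists>y. ?R y \<and> ?R (- y)"
    then have cons: "\<And>y. ?R y \<Longrightarrow> \<not> ?R (- y)" by blast
    obtain \<psi> where \<psi>: "asg \<psi>" "models \<psi> (M - {#C0#})"
      using M l unfolding mu_def sat_def by blast
    define \<phi> where "\<phi> z = (?R z \<or> (\<not> ?R (- z) \<and> \<psi> z))" for z
    have "asg \<phi>"
      using \<psi>(1) cons by (auto simp: asg_def \<phi>_def)
    moreover have "models \<phi> M"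
      unfolding models_def
    proof
      fix C assume C: "C \<in># M"
      then obtain u v where uv: "C = {#u, v#}" using M(2) by (auto simp: wf2_def)
      show "\<exists>x\<in>#C. \<phi> x"
      proof (cases "\<exists>z\<in>#C. ?R z \<or> ?R (- z)")
        case True
        then consider "?R u \<or> ?R v" | "?R (- u)" | "?R (- v)" using uv by auto
        then show ?thesis
        proof cases
          case 1 then show ?thesis using uv by (auto simp: \<phi>_def)
        next
          case 2
          moreover have "edge M (- u) v" using C uv by simp
          ultimately have "?R v" by (meson rtranclp.rtrancl_into_rtrancl)
          then show ?thesis using uv by (auto simp: \<phi>_def)
        next
          case 3
          moreover have "edge M (- v) u" using C uv by (simp add: add_mset_commute)
          ultimately have "?R u" by (meson rtranclp.rtrancl_into_rtrancl)
          then show ?thesis using uv by (auto simp: \<phi>_def)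
        qed
      next
        case False
        have "C \<noteq> C0" 
        proof
          assume "C = C0"
          with l consider "l \<in># C" | "- l \<in># C" by blast
          then show False using False by cases force+
        qed
        with C have "C \<in># M - {#C0#}" by (simp add: in_diff_count)
        with \<psi>(2) obtain z where "z \<in># C" "\<psi> z" by (auto simp: models_def)
        with False show ?thesis unfolding \<phi>_def by blast
      qed
    qed
    ultimately show False using M(1) by (auto simp: mu_def sat_def)
  qed
  then obtain y where "?R y" "?R (- y)" by blast
  then show ?thesis using edges_contra[of M l "- y"] by fastforce
qed

lemma rtrancl_path_successively: "rtrancl_path r x xs y \<Longrightarrow> successively r (x # xs) \<and> last (x # xs) = y"
  by (induction rule: rtrancl_path.induct) (auto simp: successively_Cons)

text \<open>Distinct vertices on a path need not have distinct variables; cutting at the first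
  repeated variable turns a simple path into a lollipop. Induction from the right lets a cut inside
  the prefix take precedence.\<close>

lemma first_complement:
  fixes xs :: "int list"
  assumes "distinct xs" "y \<in> set xs" "- y \<in> set xs" "0 \<notin> set xs"
  shows "\<exists>ys z zs. xs = ys @ z # zs \<and> - z \<in> set ys \<and> distinct (map abs ys)"
  using assms
proof (induction xs arbitrary: y rule: rev_induct)
  case (snoc x xs)
  show ?case
  proof (cases "\<exists>y. y \<in> set xs \<and> - y \<in> set xs")
    case True
    then obtain y' where "y' \<in> set xs" "- y' \<in> set xs" by blast
    with snoc.IH[of y'] snoc.prems obtain ys z zs where
      "xs = ys @ z # zs \<and> - z \<in> set ys \<and> distinct (map abs ys)" by auto
    then show ?thesis by (intro exI[of _ ys] exI[of _ z] exI[of _ "zs @ [x]"]) auto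
  next
    case False
    have "- x \<in> set xs"
      using snoc.prems False by (auto simp: minus_equation_iff)
    moreover have "distinct (map abs xs)"
      using False snoc.prems by (auto simp: distinct_map inj_on_def abs_eq_iff)
    ultimately show ?thesis by (intro exI[of _ xs] exI[of _ x] exI[of _ "[]"]) auto
  qed
qed simp

lemma lollipop_exists:
  assumes M: "mu M" "wf2 M" and l: "C \<in># M" "l \<in># C \<or> - l \<in># C"
  shows "\<exists>xs y. lollipop M l xs y"
proof -
  have l0: "l \<noteq> 0" using assms wf2_nonzero by fastforce
  from mu_reaches_compl[OF assms] obtain xs where "rtrancl_path (edge M) l xs (- l)"
    by (auto simp: rtranclp_eq_rtrancl_path)
  then obtain xs where xs: "rtrancl_path (edge M) l xs (- l)" "distinct (l # xs)"
    by (rule rtrancl_path_distinct)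
  from rtrancl_path_successively[OF xs(1)] have s: "successively (edge M) (l # xs)"
    and "last (l # xs) = - l" by auto
  then have "- l \<in> set (l # xs)" by (metis last_in_set list.distinct(1))
  moreover have "0 \<notin> set xs"
  proof -
    have "0 \<notin> set zs" if "successively (edge M) (z # zs)" for z zs
      using that
    proof (induction zs arbitrary: z)
      case (Cons a zs)
      then have "edge M z a" by simp
      then have "a \<noteq> 0" using M(2) wf2_nonzero by fastforce
      with Cons show ?case by auto
    qed simp
    with s show ?thesis by blast
  qed
  ultimately obtain ys z zs where ys: "l # xs = ys @ z # zs" "- z \<in> set ys" "distinct (map abs ys)"
    using first_complement[of "l # xs" l] xs(2) l0 by auto
  then have "ys \<noteq> []" by auto
  then have "hd ys = l" using ys(1) by (metis hd_append2 list.sel(1))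
  have "successively (edge M) (ys @ z # zs)" using s ys(1) by simp
  with \<open>ys \<noteq> []\<close> have "successively (edge M) ys" "edge M (last ys) z"
    by (auto simp: successively_append_iff)
  \<comment> \<open>The path is cut before \<open>z\<close>, and the edge into \<open>z\<close>
    becomes the closing edge, so the vertex called \<open>y\<close> is \<open>- z\<close>.\<close>
  then show ?thesis using ys \<open>ys \<noteq> []\<close> \<open>hd ys = l\<close>
    unfolding lollipop_def by (intro exI[of _ ys] exI[of _ "- z"]) auto
qed

section \<open>Occurrences of literals along a walk\<close>

fun walk_clauses :: "int list \<Rightarrow> int \<Rightarrow> int multiset multiset" where
  "walk_clauses [] y = {#}"
| "walk_clauses [x] y = {#{#- x, - y#}#}"
| "walk_clauses (x # x' # xs) y = add_mset {#- x, x'#} (walk_clauses (x' # xs) y)"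

text \<open>A vertex \<open>x\<close> puts \<open>- x\<close> into the clause of the edge leaving it
  and \<open>x\<close> into that of the edge entering it; the start is not entered, and the closing
  edge adds \<open>- y\<close>.\<close>

lemma deg_walk_clauses:
  "xs \<noteq> [] \<Longrightarrow> deg (walk_clauses xs y) z =
    count (mset xs) (- z) + count (mset (tl xs)) z + (if z = - y then 1 else 0)"
  by (induction xs y rule: walk_clauses.induct) auto

lemma walk_clauses_subset:
  "successively (edge M) xs \<Longrightarrow> xs \<noteq> [] \<Longrightarrow> edge M (last xs) (- y) \<Longrightarrow>
    set_mset (walk_clauses xs y) \<subseteq> set_mset M"
  by (induction xs y rule: walk_clauses.induct) auto

text \<open>Unit propagation along the walk.\<close>

lemma walk_clauses_models:
  assumes "asg \<phi>" "models \<phi> (walk_clauses xs y)" "xs \<noteq> []" "\<phi> (hd xs)" "0 \<notin> set xs"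
  shows "(\<forall>x\<in>set xs. \<phi> x) \<and> \<phi> (- y)"
  using assms
proof (induction xs y rule: walk_clauses.induct)
  case (2 x y)
  then show ?case using asg_minus[of \<phi> x] by simp
next
  case (3 x x' xs y)
  from "3.prems" have "\<phi> x'" using asg_minus[of \<phi> x] by simp
  with "3.prems" have "(\<forall>x\<in>set (x' # xs). \<phi> x) \<and> \<phi> (- y)" by (intro "3.IH") simp_all
  with "3.prems" show ?case by simp
qed simp

lemma lollipop_nonzero:
  assumes "lollipop M l xs y" "wf2 M" shows "0 \<notin> set xs"
proof -
  have "successively (edge M) xs \<Longrightarrow> xs \<noteq> [] \<Longrightarrow> edge M (last xs) (- y) \<Longrightarrow> 0 \<notin> set xs"
  proof (induction xs rule: induct_list012)
    case (2 x)
    then have "edge M x (- y)" by simp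
    then have "- x \<noteq> 0" using wf2_nonzero[OF assms(2)] by fastforce
    then show ?case by simp
  next
    case (3 x x' xs)
    then have "edge M x x'" by simp
    then have "- x \<noteq> 0" using wf2_nonzero[OF assms(2)] by fastforce
    then show ?case using 3 by simp
  qed simp
  then show ?thesis using assms(1) by (simp add: lollipop_def)
qed

lemma lollipop_models:
  assumes "lollipop M l xs y" "wf2 M" "asg \<phi>" "models \<phi> (walk_clauses xs y)"
  shows "\<not> \<phi> l"
proof
  assume "\<phi> l"
  have nz: "0 \<notin> set xs" using lollipop_nonzero[OF assms(1,2)] .
  with assms \<open>\<phi> l\<close> have "(\<forall>x\<in>set xs. \<phi> x) \<and> \<phi> (- y)"
    by (intro walk_clauses_models) (auto simp: lollipop_def)
  moreover have "y \<in> set xs" using assms(1) by (simp add: lollipop_def)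
  moreover from this have "y \<noteq> 0" using nz by auto
  ultimately show False using assms(3) by (auto simp: asg_def)
qed

lemma mu_subset_lollipops:
  assumes "mu M" "wf2 M" "lollipop M l xs y" "lollipop M (- l) xs' y'" "l \<noteq> 0"
  shows "M \<subseteq># walk_clauses xs y + walk_clauses xs' y'"
proof (rule mu_subset_unsat[OF assms(1)])
  show "set_mset (walk_clauses xs y + walk_clauses xs' y') \<subseteq> set_mset M"
    using assms(3,4) walk_clauses_subset by (auto simp: lollipop_def)
  show "\<not> sat (walk_clauses xs y + walk_clauses xs' y')"
  proof
    assume "sat (walk_clauses xs y + walk_clauses xs' y')"
    then obtain \<phi> where "asg \<phi>" "models \<phi> (walk_clauses xs y)" "models \<phi> (walk_clauses xs' y')"
      by (auto simp: sat_def)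
    then have "\<not> \<phi> l" "\<not> \<phi> (- l)"
      using lollipop_models assms by blast+
    with \<open>asg \<phi>\<close> assms(5) show False by (simp add: asg_def)
  qed
qed

lemma count_abs_distinct:
  fixes xs :: "int list"
  assumes "distinct (map abs xs)" "z \<noteq> 0"
  shows "count (mset xs) z + count (mset xs) (- z) \<le> 1"
  using assms
proof (induction xs)
  case (Cons x xs)
  have "count (mset xs) w = 0" if "\<bar>w\<bar> = \<bar>x\<bar>" for w
    using Cons.prems(1) that by (auto simp: count_eq_zero_iff image_iff)
  then show ?case using Cons by (auto simp: abs_eq_iff)
qed simp

text \<open>The variable of \<open>l\<close> occurs only at the start of \<open>xs\<close>, so no
  edge enters \<open>l\<close>; the literal \<open>- l\<close> comes once from the edge leaving
  \<open>l\<close> and once more if the walk closes at \<open>l\<close>.\<close>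

lemma lollipop_deg_start:
  assumes "lollipop M l xs y" "wf2 M"
  shows "deg (walk_clauses xs y) l = 0"
    and "deg (walk_clauses xs y) (- l) = (if y = l then 2 else 1)"
proof -
  have nz: "0 \<notin> set xs" using lollipop_nonzero[OF assms] .
  obtain ys where xs: "xs = l # ys" using assms(1) unfolding lollipop_def by (cases xs) auto
  have l0: "l \<noteq> 0" using xs nz by auto
  have "l \<notin> set ys" "- l \<notin> set ys" "- l \<notin> set xs"
    using assms(1) xs l0 by (auto simp: lollipop_def image_iff)
  moreover have "y \<noteq> - l" using calculation assms(1) by (auto simp: lollipop_def)
  ultimately show "deg (walk_clauses xs y) l = 0"
    and "deg (walk_clauses xs y) (- l) = (if y = l then 2 else 1)"
    using xs l0 by (auto simp: deg_walk_clauses count_eq_zero_iff)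
qed

lemma nbs_nonempty_nonzero: "wf2 M \<Longrightarrow> nbs M z \<noteq> {#} \<Longrightarrow> z \<noteq> 0"
  using nbs_eq_empty_iff wf2_nonzero by blast

lemma mu_compl_occurs:
  assumes "mu M" "wf2 M" "nbs M l \<noteq> {#}"
  shows "nbs M (- l) \<noteq> {#}"
proof -
  obtain C where "C \<in># M" "l \<in># C" using assms nbs_eq_empty_iff by blast
  then obtain xs y where L: "lollipop M l xs y" using lollipop_exists assms by blast
  then obtain ys where "xs = l # ys" unfolding lollipop_def by (cases xs) auto
  with L have "\<exists>z. edge M l z" unfolding lollipop_def by (cases ys) auto
  then show ?thesis using in_nbs_iff[OF assms(2)] by (metis empty_not_add_mset multi_member_split)
qed

lemma mu_lollipop_exists:
  assumes "mu M" "wf2 M" "nbs M l \<noteq> {#}"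
  shows "\<exists>xs y. lollipop M l xs y" "\<exists>xs y. lollipop M (- l) xs y"
proof -
  obtain C where "C \<in># M" "l \<in># C" using assms nbs_eq_empty_iff by blast
  then show "\<exists>xs y. lollipop M l xs y" "\<exists>xs y. lollipop M (- l) xs y" using lollipop_exists assms by simp_all
qed

text \<open>The two walks are started at the variable in question: the one from \<open>l\<close>
  contributes nothing to the degree of \<open>l\<close>, the one from \<open>- l\<close> at most
  two.\<close>

lemma mu_deg_le:
  assumes "mu M" "wf2 M" shows "deg M l \<le> 2"
proof (cases "nbs M l = {#}")
  case False
  have l0: "l \<noteq> 0" using False nbs_nonempty_nonzero assms by blast
  obtain xs y xs' y' where L: "lollipop M l xs y" "lollipop M (- l) xs' y'"
    using mu_lollipop_exists[OF assms False] by blast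
  have "deg M l \<le> deg (walk_clauses xs y) l + deg (walk_clauses xs' y') l"
    using deg_mono[OF mu_subset_lollipops[OF assms L l0]] by simp
  then show ?thesis using lollipop_deg_start[OF L(1)] lollipop_deg_start[OF L(2)] assms(2)
    by (simp split: if_splits)
qed simp

section \<open>Saturated clause-sets, where every occurring literal has degree two\<close>

definition saturated :: "int multiset multiset \<Rightarrow> bool" where
  "saturated M \<longleftrightarrow> (\<forall>z. nbs M z \<noteq> {#} \<longrightarrow> deg M z = 2)"

lemma saturatedD: "saturated M \<Longrightarrow> nbs M z \<noteq> {#} \<Longrightarrow> deg M z = 2"
  by (simp add: saturated_def)

text \<open>In the saturated case a lollipop closes at its start and meets every variable: each literal
  has to receive both of its occurrences from the two lollipops starting at \<open>l\<close> and \<open>- l\<close>.\<close>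

lemma lollipop_spanning:
  assumes M: "mu M" "wf2 M" and sat2: "saturated M"
    and L: "lollipop M l xs y"
  shows "y = l" and "nbs M z \<noteq> {#} \<Longrightarrow> z \<in> set xs \<or> - z \<in> set xs"
proof -
  have l0: "l \<noteq> 0" using L lollipop_nonzero[OF L M(2)] unfolding lollipop_def by (metis hd_in_set)
  obtain ys where xs: "xs = l # ys" using L unfolding lollipop_def by (cases xs) auto
  then have "\<exists>z. edge M l z" using L unfolding lollipop_def by (cases ys) auto
  then have occ: "nbs M (- l) \<noteq> {#}"
    using in_nbs_iff[OF M(2)] by (metis empty_not_add_mset multi_member_split)
  then have occ': "nbs M l \<noteq> {#}" using mu_compl_occurs[OF M occ] by simp
  obtain xs' y' where L': "lollipop M (- l) xs' y'" using mu_lollipop_exists[OF M occ'] by blast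
  have le: "deg M z \<le> deg (walk_clauses xs y) z + deg (walk_clauses xs' y') z" for z
    using deg_mono[OF mu_subset_lollipops[OF M L L' l0]] by simp
  \<comment> \<open>At \<open>- l\<close> the second walk contributes nothing, so the first has to
    supply both occurrences, which it does only by closing at \<open>l\<close>.\<close>
  show "y = l"
    using le[of "- l"] saturatedD[OF sat2 occ] lollipop_deg_start(2)[OF L M(2)] lollipop_deg_start(1)[OF L' M(2)]
    by (simp split: if_splits)
  have y': "y' = - l"
    using le[of l] saturatedD[OF sat2 occ'] lollipop_deg_start(1)[OF L M(2)] lollipop_deg_start(2)[OF L' M(2)]
    by (simp split: if_splits)
  assume z: "nbs M z \<noteq> {#}"
  show "z \<in> set xs \<or> - z \<in> set xs"
  proof (rule ccontr)
    assume n: "\<not> (z \<in> set xs \<or> - z \<in> set xs)"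
    then have zl: "z \<noteq> l" "z \<noteq> - l" using xs by auto
    have z0: "z \<noteq> 0" using z nbs_nonempty_nonzero M by blast
    \<comment> \<open>With nothing from the first walk, the second would have to supply both
      occurrences of \<open>z\<close>, but its variables are distinct and it closes elsewhere, so it
      supplies at most one.\<close>
    have "deg (walk_clauses xs y) z = 0"
      using n xs zl \<open>y = l\<close> by (simp add: deg_walk_clauses count_eq_zero_iff)
    moreover have tl: "count (mset (tl xs')) z \<le> count (mset xs') z" by (cases xs') auto
    have "xs' \<noteq> []" "distinct (map abs xs')" using L' by (auto simp: lollipop_def)
    then have "deg (walk_clauses xs' y') z \<le> 1"
      using count_abs_distinct[of xs' z] z0 zl y' tl by (simp add: deg_walk_clauses)
    ultimately show False using le[of z] saturatedD[OF sat2 z] by simp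
  qed
qed

text \<open>Contraposition turns the closed walk around, so that facts about its first vertex also
  apply to its negated last vertex.\<close>

lemma lollipop_reverse:
  assumes "lollipop M l (l # ys) l" "ys \<noteq> []"
  shows "lollipop M l (l # rev (map uminus ys)) l"
proof -
  have s: "successively (edge M) ys" "edge M l (hd ys)" "edge M (last ys) (- l)"
    using assms by (auto simp: lollipop_def successively_Cons)
  have "successively (\<lambda>x y. edge M y x) (map uminus ys)"
    unfolding successively_map
    by (rule successively_mono[OF s(1)]) (simp_all add: add_mset_commute)
  then have "successively (edge M) (rev (map uminus ys))"
    by (simp add: successively_rev)
  moreover have "hd (rev (map uminus ys)) = - last ys" "last (rev (map uminus ys)) = - hd ys"
    using assms(2) by (simp_all add: hd_rev last_rev last_map hd_map)
  moreover have "distinct (map abs (l # rev (map uminus ys)))"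
    using assms(1) by (simp add: lollipop_def rev_map comp_def image_image flip: rev_map)
  ultimately show ?thesis
    using assms(2) edge_contra[OF s(2)] edge_contra[OF s(3)]
    unfolding lollipop_def by (simp add: successively_Cons)
qed

text \<open>Besides the successor of \<open>p\<close>, the literal \<open>- p\<close> has another
  neighbour \<open>u\<close>. The case \<open>u = p\<close> is a tautology; at any other place
  except \<open>l\<close>, the edge from \<open>p\<close> to \<open>u\<close> gives a lollipop from
  \<open>l\<close> that closes at \<open>p\<close> or misses the variable of that successor,
  contrary to \<open>lollipop_spanning\<close>.\<close>

lemma lollipop_back_edge:
  assumes M: "mu M" "wf2 M" and sat2: "saturated M"
    and L: "lollipop M l (l # p # ys) l"
  shows "{#l, - p#} \<in># M"
proof -
  note span = lollipop_spanning[OF M sat2]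
  have nz: "0 \<notin> set (l # p # ys)" using lollipop_nonzero[OF L M(2)] .
  \<comment> \<open>The successor of \<open>p\<close> on the walk; after the last vertex this is the
    target of the closing edge.\<close>
  define q where "q = (if ys = [] then - l else hd ys)"
  have pq: "edge M p q" using L unfolding lollipop_def q_def by (cases ys) auto
  have lp: "edge M l p" using L unfolding lollipop_def by simp
  have dist: "distinct (map abs (l # p # ys))" using L by (simp add: lollipop_def)
  have "nbs M (- p) \<noteq> {#}" using pq in_nbs_iff[OF M(2)] by (metis empty_not_add_mset multi_member_split)
  then have "deg M (- p) = 2" by (rule saturatedD[OF sat2])
  moreover have q: "q \<in># nbs M (- p)" using pq in_nbs_iff[OF M(2)] by blast
  ultimately have "size (nbs M (- p) - {#q#}) = 1" by (simp add: size_Diff_singleton)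
  then obtain u where "nbs M (- p) - {#q#} = {#u#}" using size_1_singleton_mset by blast
  then have N: "nbs M (- p) = {#q, u#}" using q by (metis insert_DiffM)
  then have pu: "edge M p u" using in_nbs_iff[OF M(2)] by (metis union_single_eq_member add_mset_commute)
  have "q \<noteq> - p" using dist by (cases ys) (auto simp: q_def)
  \<comment> \<open>As \<open>q\<close> is not \<open>- p\<close>, equal neighbours could only come
    from two copies of one clause.\<close>
  have "q \<noteq> u"
  proof
    assume "q = u"
    then obtain M' where M': "M = add_mset {#- p, u#} M'" using pu by (metis insert_DiffM)
    then have "u \<in># nbs M' (- p)" using N \<open>q = u\<close> \<open>q \<noteq> - p\<close> by (auto split: if_splits)
    then have "{#- p, u#} \<in># M'" using in_nbs_iff M(2) M' by (metis wf2_add)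
    then have "count M {#- p, u#} \<ge> 2" using M' by (simp add: Suc_le_eq count_greater_zero_iff)
    then show False using mu_count[OF M(1), of "{#- p, u#}"] by simp
  qed
  have u0: "u \<noteq> 0" using pu M(2) wf2_nonzero by fastforce
  have "nbs M u \<noteq> {#}" using pu nbs_eq_empty_iff[OF M(2)] by fastforce
  with span(2)[OF L, of u] have "u \<in> set (l # p # ys) \<or> - u \<in> set (l # p # ys)" by blast
  moreover have "u \<noteq> p" using mu_no_taut[OF M] pu by (metis add_mset_commute)
  \<comment> \<open>From \<open>- u\<close> the contrapositive edge leads back to
    \<open>- p\<close>, so the walk up to \<open>- u\<close> would close at
    \<open>p\<close>.\<close>
  moreover have "- u \<notin> set (p # ys)"
  proof
    assume "- u \<in> set (p # ys)"
    then obtain zs zs' where z: "p # ys = zs @ - u # zs'" by (meson split_list)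
    have "lollipop M l (l # zs @ [- u]) p"
      unfolding lollipop_def
    proof (intro conjI)
      have "successively (edge M) (l # zs @ - u # zs')" using L z by (simp add: lollipop_def)
      then show "successively (edge M) (l # zs @ [- u])"
        by (auto simp: successively_Cons successively_append_iff hd_append split: if_splits)
      show "distinct (map abs (l # zs @ [- u]))" using dist z by auto
      show "p \<in> set (l # zs @ [- u])" using z by (cases zs) auto
      show "edge M (last (l # zs @ [- u])) (- p)" using edge_contra[OF pu] by simp
    qed auto
    then have "p = l" using span(1) by blast
    then show False using dist by simp
  qed
  \<comment> \<open>The edge from \<open>p\<close> to \<open>- l\<close> would close the walk at
    once and miss \<open>q\<close>.\<close>
  moreover have "u \<noteq> - l"
  proof
    assume "u = - l"
    have "lollipop M l [l, p] l" using lp pu \<open>u = - l\<close> dist by (simp add: lollipop_def)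
    moreover have "ys \<noteq> []" using \<open>u = - l\<close> \<open>q \<noteq> u\<close> by (auto simp: q_def)
    then have "q \<in> set ys" by (simp add: q_def)
    have "nbs M q \<noteq> {#}" using pq nbs_eq_empty_iff[OF M(2)] by fastforce
    ultimately have "q \<in> set [l, p] \<or> - q \<in> set [l, p]" using span(2) by blast
    then show False using \<open>q \<in> set ys\<close> dist by (auto simp: image_iff) 
  qed
  \<comment> \<open>The edge from \<open>p\<close> to \<open>u\<close> would be a shortcut past
    \<open>q\<close>.\<close>
  moreover have "u \<notin> set ys"
  proof
    assume "u \<in> set ys"
    then obtain zs zs' where z: "ys = zs @ u # zs'" by (meson split_list)
    then have "zs \<noteq> []" "q = hd zs" using \<open>q \<noteq> u\<close> by (auto simp: q_def hd_append split: if_splits)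
    have "lollipop M l (l # p # u # zs') l"
      unfolding lollipop_def
    proof (intro conjI)
      have "successively (edge M) (u # zs')" using L z
        by (auto simp: lollipop_def successively_Cons successively_append_iff)
      then show "successively (edge M) (l # p # u # zs')" using lp pu by simp
      show "distinct (map abs (l # p # u # zs'))" using dist z by auto
      show "edge M (last (l # p # u # zs')) (- l)" using L z by (simp add: lollipop_def)
    qed auto
    moreover have "nbs M q \<noteq> {#}" using pq nbs_eq_empty_iff[OF M(2)] by fastforce
    ultimately have "q \<in> set (l # p # u # zs') \<or> - q \<in> set (l # p # u # zs')"
      using span(2) by blast
    then have "\<bar>q\<bar> \<in> abs ` set (l # p # u # zs')" by (metis abs_minus_cancel imageI)
    moreover have "\<bar>q\<bar> \<in> abs ` set zs" using \<open>zs \<noteq> []\<close> \<open>q = hd zs\<close> by simp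
    moreover have "abs ` set (l # p # u # zs') \<inter> abs ` set zs = {}"
    proof -
      have "mset (map abs (l # p # ys)) = mset (map abs zs @ map abs (l # p # u # zs'))"
        by (simp add: z)
      with dist have "distinct (map abs zs @ map abs (l # p # u # zs'))"
        by (metis mset_eq_imp_distinct_iff)
      then show ?thesis unfolding distinct_append set_map by blast
    qed
    ultimately show False by blast
  qed
  ultimately have "u = l" by (auto simp: minus_equation_iff)
  then show ?thesis using pu by (simp add: add_mset_commute)
qed

text \<open>The first vertex and the negated last vertex of the closed walk from \<open>l\<close>
  are the two successors of \<open>l\<close>, and back edges make \<open>l\<close> equivalent to
  both. A walk with \<open>l\<close> as its only vertex means the clauses \<open>{l, l}\<close> and
  \<open>{- l, - l}\<close>, with \<open>p = q = - l\<close>.\<close>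

lemma mu_saturated_nbs:
  assumes M: "mu M" "wf2 M" and sat2: "saturated M"
    and l: "nbs M l \<noteq> {#}"
  obtains p q where "nbs M (- l) = {#p, q#}" "nbs M l = {#- p, - q#}" "p \<noteq> l" "q \<noteq> l"
proof -
  obtain xs y where L: "lollipop M l xs y" using mu_lollipop_exists(1)[OF M l] by blast
  have l0: "l \<noteq> 0" using l nbs_nonempty_nonzero M by blast
  have yl: "y = l" using lollipop_spanning(1)[OF M sat2 L] .
  obtain ys where xs: "xs = l # ys" using L unfolding lollipop_def by (cases xs) auto
  have l': "nbs M (- l) \<noteq> {#}" using mu_compl_occurs[OF M l] .
  show thesis
  proof (cases ys)
    case Nil
    then have "edge M l (- l)" using L xs yl by (simp add: lollipop_def)
    then obtain M' where M': "M = add_mset {#- l, - l#} M'" by (metis insert_DiffM)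
    then have N: "nbs M (- l) = {#- l, - l#}"
      using saturatedD[OF sat2 l'] by simp
    obtain xs' y' where L': "lollipop M (- l) xs' y'" using mu_lollipop_exists(2)[OF M l] by blast
    have y': "y' = - l" using lollipop_spanning(1)[OF M sat2 L'] .
    have only: "z = l \<or> z = - l" if "nbs M z \<noteq> {#}" for z
      using lollipop_spanning(2)[OF M sat2 L that] xs Nil by (auto simp: minus_equation_iff)
    \<comment> \<open>No variable other than that of \<open>l\<close> occurs, so the walk from
      \<open>- l\<close> has no second vertex.\<close>
    have "xs' = [- l]"
    proof -
      obtain zs where xs': "xs' = - l # zs" using L' unfolding lollipop_def by (cases xs') auto
      have "zs = []"
      proof (rule ccontr)
        assume "zs \<noteq> []"
        then obtain z zs' where zs: "zs = z # zs'" by (cases zs) auto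
        then have "edge M (- l) z" using L' xs' by (simp add: lollipop_def)
        then have "nbs M z \<noteq> {#}" using nbs_eq_empty_iff[OF M(2)] by fastforce
        then have "z = l \<or> z = - l" by (rule only)
        then show False using L' xs' zs by (auto simp: lollipop_def)
      qed
      then show ?thesis using xs' by simp
    qed
    then have "edge M (- l) l" using L' y' by (simp add: lollipop_def)
    then obtain M'' where M'': "M = add_mset {#l, l#} M''" by (metis insert_DiffM minus_minus)
    then have "nbs M l = {#l, l#}"
      using saturatedD[OF sat2 l] by simp
    then show thesis using that[of "- l" "- l"] N l0 by auto
  next
    case (Cons p zs)
    have L1: "lollipop M l (l # p # zs) l" using L xs Cons yl by simp
    then have e1: "{#l, - p#} \<in># M" using lollipop_back_edge[OF M sat2] by blast
    define q where "q = last ys"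
    obtain us where "ys = us @ [q]"
      using Cons unfolding q_def by (metis append_butlast_last_id list.distinct(1))
    then obtain zs' where r: "rev (map uminus ys) = - q # zs'" by simp
    have "lollipop M l (l # rev (map uminus ys)) l"
      using lollipop_reverse[of M l ys] L xs yl Cons by simp
    then have L2: "lollipop M l (l # - q # zs') l" by (simp add: r)
    then have e2: "{#l, q#} \<in># M" using lollipop_back_edge[OF M sat2 L2] by simp
    have e3: "edge M l p" "edge M l (- q)" using L1 L2 by (auto simp: lollipop_def)
    have d: "distinct (map abs (l # p # zs))" "p \<noteq> 0" "q \<in> set (p # zs)"
      using L1 lollipop_nonzero[OF L1 M(2)] Cons unfolding lollipop_def q_def by auto
    then have ql: "p \<noteq> l" "- q \<noteq> l" by (auto simp: image_iff)
    \<comment> \<open>The two successors of \<open>l\<close> differ, so together they exhaust the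
      degree two.\<close>
    have "p \<noteq> - q"
    proof (cases zs)
      case Nil then show ?thesis using d by auto
    next
      case (Cons z zs'')
      then have "q \<in> set zs" using \<open>ys = p # zs\<close> by (auto simp: q_def)
      then show ?thesis using d(1) by (auto simp: image_iff)
    qed
    have two: "A = {#a, b#}" if A: "size A = 2" "a \<in># A" "b \<in># A" "a \<noteq> b" for A :: "int multiset" and a b
    proof -
      obtain A' where A': "A = add_mset a A'" using A(2) by (metis insert_DiffM)
      then obtain A'' where "A' = add_mset b A''" using A(3,4) by (metis insert_DiffM insert_noteq_member)
      with A' A(1) show ?thesis by simp
    qed
    have "nbs M (- l) = {#p, - q#}"
      using two[of "nbs M (- l)" p "- q"] saturatedD[OF sat2 l'] e3 \<open>p \<noteq> - q\<close> in_nbs_iff[OF M(2)] by blast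
    moreover have "nbs M l = {#- p, - (- q)#}"
      using two[of "nbs M l" "- p" q] saturatedD[OF sat2 l] e1 e2 \<open>p \<noteq> - q\<close> in_nbs_iff[OF M(2)]
      by (metis minus_minus)
    ultimately show thesis using that ql by blast
  qed
qed

section \<open>Reductions\<close>

lemma sat_substitute:
  assumes "wf2 T" "a \<noteq> l" "a \<noteq> - l" "l \<noteq> 0" "\<forall>C\<in>#T. l \<notin># C"
  shows "sat (add_mset {#l, a#} T) \<longleftrightarrow> sat (image_mset (image_mset (\<lambda>z. if z = - l then a else z)) T)"
    (is "_ \<longleftrightarrow> sat (image_mset (image_mset ?\<sigma>) T)")
proof
  assume "sat (add_mset {#l, a#} T)"
  then obtain \<phi> where \<phi>: "asg \<phi>" "\<phi> l \<or> \<phi> a" "models \<phi> T" by (auto simp: sat_def)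
  have "models \<phi> (image_mset (image_mset ?\<sigma>) T)"
    unfolding models_def
  proof
    fix D assume "D \<in># image_mset (image_mset ?\<sigma>) T"
    then obtain C where C: "C \<in># T" "D = image_mset ?\<sigma> C" by auto
    then obtain z where z: "z \<in># C" "\<phi> z" using \<phi>(3) by (auto simp: models_def)
    \<comment> \<open>If \<open>z\<close> is \<open>- l\<close>, then \<open>l\<close> is false and
      the clause \<open>{l, a}\<close> makes \<open>a\<close> true.\<close>
    then have "\<phi> (?\<sigma> z)" using \<phi> assms(4) by (auto simp: asg_def)
    moreover have "?\<sigma> z \<in># D" unfolding C(2) using imageI[OF z(1), of ?\<sigma>] by (simp only: set_image_mset)
    ultimately show "\<exists>x\<in>#D. \<phi> x" by blast
  qed
  then show "sat (image_mset (image_mset ?\<sigma>) T)" using \<phi> by (auto simp: sat_def)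
next
  assume "sat (image_mset (image_mset ?\<sigma>) T)"
  then obtain \<phi> where \<phi>: "asg \<phi>" "models \<phi> (image_mset (image_mset ?\<sigma>) T)" by (auto simp: sat_def)
  \<comment> \<open>Giving \<open>- l\<close> the value of \<open>a\<close> undoes the replacement,
    and \<open>{l, a}\<close> then holds by itself.\<close>
  define \<psi> where "\<psi> = \<phi>(l := \<not> \<phi> a, - l := \<phi> a)"
  have "asg \<psi>" using \<phi>(1) assms by (auto simp: \<psi>_def asg_def minus_equation_iff)
  moreover have "models \<psi> T"
    unfolding models_def
  proof
    fix C assume C: "C \<in># T"
    then have "\<exists>x\<in>#image_mset ?\<sigma> C. \<phi> x" using \<phi>(2) by (auto simp: models_def)
    then obtain z where "z \<in># C" "\<phi> (?\<sigma> z)" by auto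
    moreover have "\<psi> z = \<phi> (?\<sigma> z)" using assms C \<open>z \<in># C\<close> by (auto simp: \<psi>_def)
    ultimately show "\<exists>x\<in>#C. \<psi> x" by auto
  qed
  moreover have "\<psi> l \<or> \<psi> a" using assms by (auto simp: \<psi>_def)
  ultimately show "sat (add_mset {#l, a#} T)" by (auto simp: sat_def)
qed

text \<open>Deleting a clause of \<open>T\<close> commutes with the substitution. Deleting
  \<open>{l, a}\<close> has no counterpart on the right: making \<open>l\<close> false satisfies all
  clauses with \<open>- l\<close>, \<open>C0\<close> among them, so a model of the image without
  \<open>C0\<close> is enough.\<close>

lemma mu_substitute:
  assumes "wf2 T" "a \<noteq> l" "a \<noteq> - l" "l \<noteq> 0" "\<forall>C\<in>#T. l \<notin># C" "C0 \<in># T" "- l \<in># C0"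
  shows "mu (add_mset {#l, a#} T) \<longleftrightarrow> mu (image_mset (image_mset (\<lambda>z. if z = - l then a else z)) T)"
    (is "_ \<longleftrightarrow> mu (image_mset (image_mset ?\<sigma>) T)")
proof -
  let ?I = "image_mset (image_mset ?\<sigma>)"
  have sub: "sat (add_mset {#l, a#} (T - {#C#})) \<longleftrightarrow> sat (?I (T - {#C#}))" for C
  proof -
    have "wf2 (T - {#C#})" using assms(1) wf2_subset by simp
    moreover have "\<forall>D\<in>#T - {#C#}. l \<notin># D" using assms(5) by (meson in_diffD)
    ultimately show ?thesis using sat_substitute assms by blast
  qed
  have del: "add_mset {#l, a#} T - {#C#} = add_mset {#l, a#} (T - {#C#})" if "C \<in># T" for C
    using diff_union_single_conv[OF that, of "{#{#l, a#}#}"] by simp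
  have img: "?I T - {#image_mset ?\<sigma> C#} = ?I (T - {#C#})" if "C \<in># T" for C
    using that by (simp add: image_mset_Diff)
  have last: "sat T" if "sat (?I (T - {#C0#}))"
  proof -
    from that obtain \<phi> where \<phi>: "asg \<phi>" "models \<phi> (?I (T - {#C0#}))" by (auto simp: sat_def)
    define \<psi> where "\<psi> = \<phi>(l := False, - l := True)"
    have "asg \<psi>" using \<phi>(1) assms(4) by (auto simp: \<psi>_def asg_def minus_equation_iff)
    moreover have "models \<psi> T"
      unfolding models_def
    proof
      fix C assume C: "C \<in># T"
      show "\<exists>x\<in>#C. \<psi> x"
      proof (cases "- l \<in># C")
        case True then show ?thesis by (intro bexI[of _ "- l"]) (simp_all add: \<psi>_def)
      next
        case False
        with assms(7) have "C \<noteq> C0" by blast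
        with C have "C \<in># T - {#C0#}" by (metis insert_DiffM insert_noteq_member assms(6))
        then have "\<exists>x\<in>#image_mset ?\<sigma> C. \<phi> x" using \<phi>(2) by (auto simp: models_def)
        then obtain z where z: "z \<in># C" "\<phi> (?\<sigma> z)" by auto
        moreover have "z \<noteq> l" "z \<noteq> - l" using z False assms(5) C by auto
        ultimately show ?thesis by (auto simp: \<psi>_def)
      qed
    qed
    ultimately show ?thesis by (auto simp: sat_def)
  qed
  have "mu (add_mset {#l, a#} T) \<longleftrightarrow> \<not> sat (?I T) \<and> (\<forall>C\<in>#T. sat (?I (T - {#C#}))) \<and> sat T"
    unfolding mu_def using sat_substitute[OF assms(1-5)] sub del by auto
  also have "\<dots> \<longleftrightarrow> \<not> sat (?I T) \<and> (\<forall>C\<in>#T. sat (?I (T - {#C#})))"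
    using last assms(6) by blast
  also have "\<dots> \<longleftrightarrow> mu (?I T)"
    unfolding mu_def using img by auto
  finally show ?thesis .
qed

section \<open>Eliminating a variable\<close>

lemma sat_eliminate:
  assumes "x \<noteq> 0" "\<forall>b\<in>#A. b \<noteq> x \<and> b \<noteq> - x" "\<forall>b\<in>#B. b \<noteq> x \<and> b \<noteq> - x"
    "\<forall>C\<in>#R. x \<notin># C \<and> - x \<notin># C"
  shows "sat (image_mset (\<lambda>b. {#- x, b#}) A + image_mset (\<lambda>b. {#x, b#}) B + R) \<longleftrightarrow>
    (\<exists>\<phi>. asg \<phi> \<and> models \<phi> R \<and> ((\<forall>b\<in>#A. \<phi> b) \<or> (\<forall>b\<in>#B. \<phi> b)))"
    (is "sat ?M \<longleftrightarrow> ?rhs")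
proof
  assume "sat ?M"
  then obtain \<phi> where "asg \<phi>" "models \<phi> ?M" by (auto simp: sat_def)
  then have "models \<phi> R" and A: "\<forall>b\<in>#A. \<phi> (- x) \<or> \<phi> b" and B: "\<forall>b\<in>#B. \<phi> x \<or> \<phi> b"
    by (simp_all add: models_def ball_Un)
  moreover have "(\<forall>b\<in>#A. \<phi> b) \<or> (\<forall>b\<in>#B. \<phi> b)"
    using A B asg_minus[OF \<open>asg \<phi>\<close> assms(1)] by blast
  ultimately have "models \<phi> R" "(\<forall>b\<in>#A. \<phi> b) \<or> (\<forall>b\<in>#B. \<phi> b)" by blast+
  with \<open>asg \<phi>\<close> show ?rhs by blast
next
  assume ?rhs
  then obtain \<phi> where \<phi>: "asg \<phi>" "models \<phi> R" "(\<forall>b\<in>#A. \<phi> b) \<or> (\<forall>b\<in>#B. \<phi> b)" by blast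
  \<comment> \<open>The value of \<open>x\<close> is the conjunction of \<open>A\<close>; if that is
    false, all of \<open>B\<close> is true.\<close>
  define \<psi> where "\<psi> = \<phi>(x := (\<forall>b\<in>#A. \<phi> b), - x := (\<not> (\<forall>b\<in>#A. \<phi> b)))"
  have "asg \<psi>" using \<phi>(1) assms(1) by (auto simp: \<psi>_def asg_def minus_equation_iff)
  moreover have eq: "\<psi> z = \<phi> z" if "z \<noteq> x" "z \<noteq> - x" for z using that by (auto simp: \<psi>_def)
  have "models \<psi> R"
    unfolding models_def
  proof
    fix C assume C: "C \<in># R"
    then obtain z where "z \<in># C" "\<phi> z" using \<phi>(2) by (auto simp: models_def)
    moreover from this have "z \<noteq> x" "z \<noteq> - x" using assms(4) C by auto
    ultimately show "\<exists>z\<in>#C. \<psi> z" using eq by blast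
  qed
  moreover have "models \<psi> (image_mset (\<lambda>b. {#- x, b#}) A)"
    using assms(1,2) eq by (auto simp: models_def \<psi>_def)
  moreover have "models \<psi> (image_mset (\<lambda>b. {#x, b#}) B)"
    using assms(1,3) eq \<phi>(3) by (auto simp: models_def \<psi>_def)
  ultimately show "sat ?M" by (auto simp: sat_def)
qed

lemma mu_add: "mu (add_mset C M) \<longleftrightarrow>
    \<not> sat (add_mset C M) \<and> sat M \<and> (\<forall>D\<in>#M. sat (add_mset C (M - {#D#})))"
  unfolding mu_def
proof (intro conj_cong refl)
  have "add_mset C M - {#D#} = add_mset C (M - {#D#})" if "D \<in># M" for D
    using diff_union_single_conv[OF that, of "{#C#}"] by simp
  then show "(\<forall>D\<in>#add_mset C M. sat (add_mset C M - {#D#})) \<longleftrightarrow>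
    sat M \<and> (\<forall>D\<in>#M. sat (add_mset C (M - {#D#})))" by auto
qed

text \<open>Besides \<open>R\<close>, both sides impose the same relation on the values of
  \<open>p\<close> and \<open>q\<close>: equality for all displayed clauses, one implication after
  deleting any of them. The four deletions on the left give each implication twice, the two on the
  right once.\<close>

lemma mu_eliminate:
  assumes x: "x \<noteq> 0" "p \<noteq> x" "p \<noteq> - x" "q \<noteq> x" "q \<noteq> - x" "p \<noteq> 0" "q \<noteq> 0"
    and R: "\<forall>C\<in>#R. x \<notin># C \<and> - x \<notin># C"
  shows "mu (R + {#{#- x, p#}, {#- x, q#}, {#x, - p#}, {#x, - q#}#}) \<longleftrightarrow>
    mu (R + {#{#p, - q#}, {#q, - p#}#})"
proof -
  define S where "S R Q \<longleftrightarrow> (\<exists>\<phi>. asg \<phi> \<and> models \<phi> R \<and> Q (\<phi> p) (\<phi> q))"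
    for R and Q :: "bool \<Rightarrow> bool \<Rightarrow> bool"
  have elim: "sat (image_mset (\<lambda>b. {#- x, b#}) A + image_mset (\<lambda>b. {#x, b#}) B + R') \<longleftrightarrow>
    (\<exists>\<phi>. asg \<phi> \<and> models \<phi> R' \<and> ((\<forall>b\<in>#A. \<phi> b) \<or> (\<forall>b\<in>#B. \<phi> b)))"
    if "A \<subseteq># {#p, q#}" "B \<subseteq># {#- p, - q#}" "R' \<subseteq># R" for A B R'
  proof (rule sat_eliminate[OF x(1)])
    show "\<forall>b\<in>#A. b \<noteq> x \<and> b \<noteq> - x" using set_mset_mono[OF that(1)] x by auto
    show "\<forall>b\<in>#B. b \<noteq> x \<and> b \<noteq> - x" using set_mset_mono[OF that(2)] x by (auto simp: minus_equation_iff)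
    show "\<forall>C\<in>#R'. x \<notin># C \<and> - x \<notin># C" using R mset_subset_eqD[OF that(3)] by blast
  qed
  have m: "\<phi> (- p) \<longleftrightarrow> \<not> \<phi> p" "\<phi> (- q) \<longleftrightarrow> \<not> \<phi> q" if "asg \<phi>" for \<phi>
    using that x by (auto simp: asg_def)
  have Scong: "(\<exists>\<phi>. asg \<phi> \<and> models \<phi> R' \<and> P \<phi>) \<longleftrightarrow> S R' Q"
    if "\<And>\<phi>. asg \<phi> \<Longrightarrow> P \<phi> \<longleftrightarrow> Q (\<phi> p) (\<phi> q)" for P Q R'
    unfolding S_def using that by blast
  have e0: "sat (R' + {#{#- x, p#}, {#- x, q#}, {#x, - p#}, {#x, - q#}#}) \<longleftrightarrow> S R' (=)"
    if "R' \<subseteq># R" for R'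
  proof -
    have "R' + {#{#- x, p#}, {#- x, q#}, {#x, - p#}, {#x, - q#}#} =
      image_mset (\<lambda>b. {#- x, b#}) {#p, q#} + image_mset (\<lambda>b. {#x, b#}) {#- p, - q#} + R'"
      by (simp add: multiset_eq_iff)
    moreover have "sat (image_mset (\<lambda>b. {#- x, b#}) {#p, q#} + image_mset (\<lambda>b. {#x, b#}) {#- p, - q#} + R') \<longleftrightarrow>
      (\<exists>\<phi>. asg \<phi> \<and> models \<phi> R' \<and> ((\<forall>b\<in>#{#p, q#}. \<phi> b) \<or> (\<forall>b\<in>#{#- p, - q#}. \<phi> b)))"
      by (rule elim) (simp_all add: that)
    ultimately have "sat (R' + {#{#- x, p#}, {#- x, q#}, {#x, - p#}, {#x, - q#}#}) \<longleftrightarrow> (\<exists>\<phi>. asg \<phi> \<and> models \<phi> R' \<and>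
      ((\<forall>b\<in>#{#p, q#}. \<phi> b) \<or> (\<forall>b\<in>#{#- p, - q#}. \<phi> b)))"
      by (simp only:)
    also have "\<dots> \<longleftrightarrow> S R' (=)" by (rule Scong) (auto simp: m)
    finally show ?thesis .
  qed
  \<comment> \<open>Without \<open>{- x, p}\<close>, the variable \<open>x\<close> is still
    equivalent to \<open>q\<close> and implied by \<open>p\<close>, so what remains is that
    \<open>p\<close> implies \<open>q\<close>.\<close>
  have e1: "sat (R + {#{#- x, q#}, {#x, - p#}, {#x, - q#}#}) \<longleftrightarrow> S R (\<lambda>p q. p \<longrightarrow> q)"
  proof -
    have "R + {#{#- x, q#}, {#x, - p#}, {#x, - q#}#} =
      image_mset (\<lambda>b. {#- x, b#}) {#q#} + image_mset (\<lambda>b. {#x, b#}) {#- p, - q#} + R"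
      by (simp add: multiset_eq_iff)
    moreover have "sat (image_mset (\<lambda>b. {#- x, b#}) {#q#} + image_mset (\<lambda>b. {#x, b#}) {#- p, - q#} + R) \<longleftrightarrow>
      (\<exists>\<phi>. asg \<phi> \<and> models \<phi> R \<and> ((\<forall>b\<in>#{#q#}. \<phi> b) \<or> (\<forall>b\<in>#{#- p, - q#}. \<phi> b)))"
      by (rule elim) (simp_all)
    ultimately have "sat (R + {#{#- x, q#}, {#x, - p#}, {#x, - q#}#}) \<longleftrightarrow> (\<exists>\<phi>. asg \<phi> \<and> models \<phi> R \<and>
      ((\<forall>b\<in>#{#q#}. \<phi> b) \<or> (\<forall>b\<in>#{#- p, - q#}. \<phi> b)))"
      by (simp only:)
    also have "\<dots> \<longleftrightarrow> S R (\<lambda>p q. p \<longrightarrow> q)" by (rule Scong) (auto simp: m)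
    finally show ?thesis .
  qed
  have e2: "sat (R + {#{#- x, p#}, {#x, - p#}, {#x, - q#}#}) \<longleftrightarrow> S R (\<lambda>p q. q \<longrightarrow> p)"
  proof -
    have "R + {#{#- x, p#}, {#x, - p#}, {#x, - q#}#} =
      image_mset (\<lambda>b. {#- x, b#}) {#p#} + image_mset (\<lambda>b. {#x, b#}) {#- p, - q#} + R"
      by (simp add: multiset_eq_iff)
    moreover have "sat (image_mset (\<lambda>b. {#- x, b#}) {#p#} + image_mset (\<lambda>b. {#x, b#}) {#- p, - q#} + R) \<longleftrightarrow>
      (\<exists>\<phi>. asg \<phi> \<and> models \<phi> R \<and> ((\<forall>b\<in>#{#p#}. \<phi> b) \<or> (\<forall>b\<in>#{#- p, - q#}. \<phi> b)))"
      by (rule elim) (simp_all)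
    ultimately have "sat (R + {#{#- x, p#}, {#x, - p#}, {#x, - q#}#}) \<longleftrightarrow> (\<exists>\<phi>. asg \<phi> \<and> models \<phi> R \<and>
      ((\<forall>b\<in>#{#p#}. \<phi> b) \<or> (\<forall>b\<in>#{#- p, - q#}. \<phi> b)))"
      by (simp only:)
    also have "\<dots> \<longleftrightarrow> S R (\<lambda>p q. q \<longrightarrow> p)" by (rule Scong) (auto simp: m)
    finally show ?thesis .
  qed
  have e3: "sat (R + {#{#- x, p#}, {#- x, q#}, {#x, - q#}#}) \<longleftrightarrow> S R (\<lambda>p q. q \<longrightarrow> p)"
  proof -
    have "R + {#{#- x, p#}, {#- x, q#}, {#x, - q#}#} =
      image_mset (\<lambda>b. {#- x, b#}) {#p, q#} + image_mset (\<lambda>b. {#x, b#}) {#- q#} + R"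
      by (simp add: multiset_eq_iff)
    moreover have "sat (image_mset (\<lambda>b. {#- x, b#}) {#p, q#} + image_mset (\<lambda>b. {#x, b#}) {#- q#} + R) \<longleftrightarrow>
      (\<exists>\<phi>. asg \<phi> \<and> models \<phi> R \<and> ((\<forall>b\<in>#{#p, q#}. \<phi> b) \<or> (\<forall>b\<in>#{#- q#}. \<phi> b)))"
      by (rule elim) (simp_all)
    ultimately have "sat (R + {#{#- x, p#}, {#- x, q#}, {#x, - q#}#}) \<longleftrightarrow> (\<exists>\<phi>. asg \<phi> \<and> models \<phi> R \<and>
      ((\<forall>b\<in>#{#p, q#}. \<phi> b) \<or> (\<forall>b\<in>#{#- q#}. \<phi> b)))"
      by (simp only:)
    also have "\<dots> \<longleftrightarrow> S R (\<lambda>p q. q \<longrightarrow> p)" by (rule Scong) (auto simp: m)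
    finally show ?thesis .
  qed
  have e4: "sat (R + {#{#- x, p#}, {#- x, q#}, {#x, - p#}#}) \<longleftrightarrow> S R (\<lambda>p q. p \<longrightarrow> q)"
  proof -
    have "R + {#{#- x, p#}, {#- x, q#}, {#x, - p#}#} =
      image_mset (\<lambda>b. {#- x, b#}) {#p, q#} + image_mset (\<lambda>b. {#x, b#}) {#- p#} + R"
      by (simp add: multiset_eq_iff)
    moreover have "sat (image_mset (\<lambda>b. {#- x, b#}) {#p, q#} + image_mset (\<lambda>b. {#x, b#}) {#- p#} + R) \<longleftrightarrow>
      (\<exists>\<phi>. asg \<phi> \<and> models \<phi> R \<and> ((\<forall>b\<in>#{#p, q#}. \<phi> b) \<or> (\<forall>b\<in>#{#- p#}. \<phi> b)))"
      by (rule elim) (simp_all)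
    ultimately have "sat (R + {#{#- x, p#}, {#- x, q#}, {#x, - p#}#}) \<longleftrightarrow> (\<exists>\<phi>. asg \<phi> \<and> models \<phi> R \<and>
      ((\<forall>b\<in>#{#p, q#}. \<phi> b) \<or> (\<forall>b\<in>#{#- p#}. \<phi> b)))"
      by (simp only:)
    also have "\<dots> \<longleftrightarrow> S R (\<lambda>p q. p \<longrightarrow> q)" by (rule Scong) (auto simp: m)
    finally show ?thesis .
  qed
  have f0: "sat (R' + {#{#p, - q#}, {#q, - p#}#}) \<longleftrightarrow> S R' (=)" for R'
    unfolding sat_def S_def using m by auto
  have f1: "sat (R + {#{#q, - p#}#}) \<longleftrightarrow> S R (\<lambda>p q. p \<longrightarrow> q)"
    unfolding sat_def S_def using m by auto
  have f2: "sat (R + {#{#p, - q#}#}) \<longleftrightarrow> S R (\<lambda>p q. q \<longrightarrow> p)"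
    unfolding sat_def S_def using m by auto
  have del: "R + X - {#C#} = (R - {#C#}) + X" if "C \<in># R" for C X
    using that by simp
  have mu_union: "mu (R + X) \<longleftrightarrow> \<not> sat (R + X) \<and> (\<forall>C\<in>#R. sat ((R - {#C#}) + X)) \<and> (\<forall>C\<in>#X. sat (R + (X - {#C#})))"
    for X
  proof -
    have "R + X - {#C#} = R + (X - {#C#})" if "C \<in># X" for C
      using that by (rule diff_union_single_conv)
    then show ?thesis
      unfolding mu_def set_mset_union ball_Un
      by (intro arg_cong2[where f="(\<and>)"] refl ball_cong arg_cong[where f=sat] del)
  qed
  have e0': "sat (R - {#C#} + {#{#- x, p#}, {#- x, q#}, {#x, - p#}, {#x, - q#}#}) \<longleftrightarrow> S (R - {#C#}) (=)" for C
    by (rule e0) simp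
  have ball4: "(\<forall>C\<in>#{#c1, c2, c3, c4#}. P C) \<longleftrightarrow> P c1 \<and> P c2 \<and> P c3 \<and> P c4"
    and ball2: "(\<forall>C\<in>#{#c1, c2#}. P C) \<longleftrightarrow> P c1 \<and> P c2" for c1 c2 c3 c4 and P :: "int multiset \<Rightarrow> bool"
    by auto
  have "mu (R + {#{#- x, p#}, {#- x, q#}, {#x, - p#}, {#x, - q#}#}) \<longleftrightarrow>
    \<not> S R (=) \<and> (\<forall>C\<in>#R. S (R - {#C#}) (=)) \<and> S R (\<lambda>p q. p \<longrightarrow> q) \<and> S R (\<lambda>p q. q \<longrightarrow> p)"
  proof -
    have rot: "{#{#- x, p#}, {#- x, q#}, {#x, - p#}, {#x, - q#}#} - {#{#- x, p#}#} = {#{#- x, q#}, {#x, - p#}, {#x, - q#}#}"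
      "{#{#- x, p#}, {#- x, q#}, {#x, - p#}, {#x, - q#}#} - {#{#- x, q#}#} = {#{#- x, p#}, {#x, - p#}, {#x, - q#}#}"
      "{#{#- x, p#}, {#- x, q#}, {#x, - p#}, {#x, - q#}#} - {#{#x, - p#}#} = {#{#- x, p#}, {#- x, q#}, {#x, - q#}#}"
      "{#{#- x, p#}, {#- x, q#}, {#x, - p#}, {#x, - q#}#} - {#{#x, - q#}#} = {#{#- x, p#}, {#- x, q#}, {#x, - p#}#}"
      by (simp_all add: multiset_eq_iff)
    show ?thesis
      unfolding mu_union ball4 rot e0[OF subset_mset.order_refl] e0' e1 e2 e3 e4 by blast
  qed
  also have "\<dots> \<longleftrightarrow> mu (R + {#{#p, - q#}, {#q, - p#}#})"
  proof -
    have rot: "{#{#p, - q#}, {#q, - p#}#} - {#{#p, - q#}#} = {#{#q, - p#}#}"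
      "{#{#p, - q#}, {#q, - p#}#} - {#{#q, - p#}#} = {#{#p, - q#}#}"
      by (simp_all add: multiset_eq_iff)
    show ?thesis
      unfolding mu_union ball2 rot f0 f1 f2 by blast
  qed
  finally show ?thesis .
qed

text \<open>The two displayed clauses are contradictory alone, so minimality leaves no room for a
  third.\<close>

lemma mu_terminal:
  assumes "x \<noteq> 0"
  shows "mu (R + {#{#x, x#}, {#- x, - x#}#}) \<longleftrightarrow> R = {#}"
proof
  have unsat: "\<not> sat (R + {#{#x, x#}, {#- x, - x#}#})" for R
    using assms by (auto simp: sat_def asg_def)
  show "R = {#}" if "mu (R + {#{#x, x#}, {#- x, - x#}#})"
  proof (rule ccontr)
    assume "R \<noteq> {#}"
    then obtain C R' where "R = add_mset C R'" by (metis multiset_cases)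
    with that have "sat (R' + {#{#x, x#}, {#- x, - x#}#})" by (auto simp: mu_def)
    with unsat show False by blast
  qed
  have "sat {#{#z, z#}#}" if "z \<noteq> 0" for z
    unfolding sat_def asg_def
    by (intro exI[of _ "\<lambda>y. if z > 0 then y > 0 else y < 0"]) (use that in auto)
  then have "sat {#{#x, x#}#}" "sat {#{#- x, - x#}#}" using assms by auto
  then show "mu (R + {#{#x, x#}, {#- x, - x#}#})" if "R = {#}"
    using unsat[of "{#}"] that by (auto simp: mu_add)
qed

section \<open>Machine programs\<close>

fun loop_free :: "com \<Rightarrow> bool" where
  "loop_free (While b c) \<longleftrightarrow> False"
| "loop_free (Seq c1 c2) \<longleftrightarrow> loop_free c1 \<and> loop_free c2"
| "loop_free (If b c1 c2) \<longleftrightarrow> loop_free c1 \<and> loop_free c2"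
| "loop_free _ \<longleftrightarrow> True"

text \<open>The value for \<open>While\<close> is a placeholder; \<open>loop_free\<close> rules this
  case out.\<close>

fun run :: "com \<Rightarrow> state \<Rightarrow> state" where
  "run Skip s = s"
| "run (Assign x e) s = s\<lparr>regs := (regs s)(x := aval e s)\<rparr>"
| "run (Store a i e) s = s\<lparr>arrs := (arrs s)(a := (arrs s a)(aval i s := aval e s))\<rparr>"
| "run (Seq c1 c2) s = run c2 (run c1 s)"
| "run (If b c1 c2) s = (if bval b s then run c1 s else run c2 s)"
| "run (While b c) s = s"

text \<open>Both branches of a conditional are charged, since any bound independent of the state
  will do.\<close>

fun max_steps :: "com \<Rightarrow> nat" where
  "max_steps Skip = 1"
| "max_steps (Assign x e) = acost e + 1"
| "max_steps (Store a i e) = acost i + acost e + 1"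
| "max_steps (Seq c1 c2) = max_steps c1 + max_steps c2"
| "max_steps (If b c1 c2) = bcost b + max_steps c1 + max_steps c2 + 1"
| "max_steps (While b c) = 0"

lemma exec_run: "loop_free c \<Longrightarrow> \<exists>t\<le>max_steps c. exec c s t (run c s)"
proof (induction c arbitrary: s)
  case (Seq c1 c2)
  then obtain t1 t2 where "t1 \<le> max_steps c1" "exec c1 s t1 (run c1 s)"
    "t2 \<le> max_steps c2" "exec c2 (run c1 s) t2 (run c2 (run c1 s))" by (metis loop_free.simps(2))
  then show ?case by (intro exI[of _ "t1 + t2"]) (auto intro: exec.Seq)
next
  case (If b c1 c2)
  then obtain t1 t2 where "t1 \<le> max_steps c1" "exec c1 s t1 (run c1 s)"
    "t2 \<le> max_steps c2" "exec c2 s t2 (run c2 s)" by (metis loop_free.simps(3))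
  then show ?case
    using exec.IfTrue[of b s c1 t1 "run c1 s" c2] exec.IfFalse[of b s c2 t2 "run c2 s" c1]
    by (intro exI[of _ "bcost b + (if bval b s then t1 else t2) + 1"]) auto
next
  case Skip
  show ?case using exec.Skip[of s] by (intro exI[of _ 1]) simp
next
  case (Assign x e)
  show ?case using exec.Assign[of x e s] by (intro exI[of _ "acost e + 1"]) simp
next
  case (Store a i e)
  show ?case using exec.Store[of a i e s] by (intro exI[of _ "acost i + acost e + 1"]) simp
qed simp

section \<open>Loops over the positions of the input word\<close>

definition for_each :: "com \<Rightarrow> com" where
  "for_each c = While (Less (Reg 1) (Reg 0)) (Seq c (Assign 1 (AddC (Reg 1) 1)))"

lemma exec_for_each:
  assumes c: "loop_free c"
    and step: "\<And>i s. I i s \<Longrightarrow> i < n \<Longrightarrow> I (Suc i) (run (Seq c (Assign 1 (AddC (Reg 1) 1))) s)"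
    and regs: "\<And>i s. I i s \<Longrightarrow> regs s 0 = int n \<and> regs s 1 = int i"
    and "I 0 s"
  shows "\<exists>t s'. exec (for_each c) s t s' \<and> I n s' \<and> t \<le> (max_steps c + 7) * (n + 1)"
proof -
  \<comment> \<open>The 7 pays for one loop test (4) and one increment of register 1 (3). The
    summand 1 in \<open>n - i + 1\<close> covers the last test, which fails.\<close>
  let ?c = "Seq c (Assign 1 (AddC (Reg 1) 1))" and ?K = "max_steps c + 7"
  have "\<exists>t s'. exec (for_each c) s t s' \<and> I n s' \<and> t \<le> ?K * (n - i + 1)" if "I i s" "i \<le> n" for i s
    using that
  proof (induction "n - i" arbitrary: i s)
    case 0
    then have "i = n" by simp
    then have "exec (for_each c) s (bcost (Less (Reg 1) (Reg 0)) + 1) s"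
      unfolding for_each_def using regs[OF 0(2)] by (intro exec.WhileFalse) simp
    then show ?case using 0 \<open>i = n\<close> by (intro exI conjI) auto
  next
    case (Suc k)
    then have i: "i < n" by simp
    obtain t1 where t1: "t1 \<le> max_steps ?c" "exec ?c s t1 (run ?c s)"
      using exec_run[of ?c s] c by auto
    have k: "k = n - Suc i" using Suc.hyps(2) by simp
    obtain t2 s' where t2: "exec (for_each c) (run ?c s) t2 s'" "I n s'" "t2 \<le> ?K * (n - Suc i + 1)"
      using Suc.hyps(1)[OF k step[OF Suc.prems(1) i] Suc_leI[OF i]] by blast
    have "exec (for_each c) s (bcost (Less (Reg 1) (Reg 0)) + 1 + t1 + t2) s'"
      unfolding for_each_def
      by (rule exec.WhileTrue[OF _ t1(2)])
        (use regs[OF Suc.prems(1)] i t2(1) in \<open>simp_all add: for_each_def\<close>)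
    moreover have "bcost (Less (Reg 1) (Reg 0)) + 1 + t1 + t2 \<le> ?K * (n - i + 1)"
    proof -
      have "n - i + 1 = Suc (n - Suc i + 1)" using i by simp
      then have "?K * (n - i + 1) = ?K + ?K * (n - Suc i + 1)" by (simp only: mult_Suc_right)
      then show ?thesis using t1(1) t2(3) by simp
    qed
    ultimately show ?case using t2(2) by blast
  qed
  from this[of 0 s] assms(4) show ?thesis by simp
qed

section \<open>Neighbour lists in machine arrays\<close>

definition frame :: "nat set \<Rightarrow> state \<Rightarrow> state \<Rightarrow> bool" where
  "frame R s s' \<longleftrightarrow> (\<forall>r. r \<notin> R \<longrightarrow> regs s' r = regs s r) \<and> arrs s' 0 = arrs s 0"

lemma frame_trans: "frame R s s' \<Longrightarrow> frame R s' s'' \<Longrightarrow> frame R s s''"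
  by (simp add: frame_def)

lemma frame_mono: "frame R s s' \<Longrightarrow> R \<subseteq> R' \<Longrightarrow> frame R' s s'"
  by (auto simp: frame_def)

fun reg_lit :: "aexp \<Rightarrow> bool" where
  "reg_lit (Reg r) \<longleftrightarrow> r \<noteq> 2"
| "reg_lit (Minus e) \<longleftrightarrow> reg_lit e"
| "reg_lit _ \<longleftrightarrow> False"

lemma aval_frame: "reg_lit e \<Longrightarrow> frame {2} s s' \<Longrightarrow> aval e s' = aval e s"
  by (induction e rule: reg_lit.induct) (auto simp: frame_def)

lemma aval_arrs [simp]: "reg_lit e \<Longrightarrow> aval e (s\<lparr>arrs := A\<rparr>) = aval e s"
  by (induction e rule: reg_lit.induct) auto

text \<open>Arrays 1 and 2 hold the at most two neighbours of a literal, with 0 for a free place.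
  Register 2 is raised when a third neighbour would be needed, and on rejection.\<close>

definition stores :: "state \<Rightarrow> (int \<Rightarrow> int multiset) \<Rightarrow> bool" where
  "stores s N \<longleftrightarrow> (\<forall>z. (arrs s 1 z = 0 \<longrightarrow> arrs s 2 z = 0) \<and>
     N z = filter_mset (\<lambda>x. x \<noteq> 0) {#arrs s 1 z, arrs s 2 z#})"

text \<open>Once register 2 is raised the arrays may be out of date. What is kept is that the
  intended neighbourhoods include one of size above two, which further insertions cannot
  undo.\<close>

definition holds :: "state \<Rightarrow> (int \<Rightarrow> int multiset) \<Rightarrow> bool" where
  "holds s N \<longleftrightarrow> (if regs s 2 = 0 then stores s N else \<exists>z. size (N z) > 2)"

definition insert_nb :: "aexp \<Rightarrow> aexp \<Rightarrow> com" where
  "insert_nb e f = If (Eq (Load 1 e) (Const 0)) (Store 1 e f)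
     (If (Eq (Load 2 e) (Const 0)) (Store 2 e f) (Assign 2 (Const 1)))"

text \<open>Meant for an \<open>f\<close> that is listed at \<open>e\<close>. The second entry moves
  up so that no occupied second place stands behind a free first one; of two equal entries one
  survives.\<close>

definition delete_nb :: "aexp \<Rightarrow> aexp \<Rightarrow> com" where
  "delete_nb e f = Seq (If (Eq (Load 1 e) f) (Store 1 e (Load 2 e)) Skip) (Store 2 e (Const 0))"

text \<open>For \<open>{x, x}\<close> both insertions go to the same list, as the double count in
  \<open>nbs\<close> requires.\<close>

definition add_edge :: "aexp \<Rightarrow> aexp \<Rightarrow> com" where
  "add_edge e f = Seq (insert_nb e f) (insert_nb f e)"

definition del_edge :: "aexp \<Rightarrow> aexp \<Rightarrow> com" where
  "del_edge e f = Seq (delete_nb e f) (delete_nb f e)"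

lemma loop_free_edges [simp]: "loop_free (add_edge e f)" "loop_free (del_edge e f)"
  by (simp_all add: add_edge_def del_edge_def insert_nb_def delete_nb_def)

lemma run_insert_nb_frame: "frame {2} s (run (insert_nb e f) s)"
  by (simp add: insert_nb_def frame_def)

lemma run_insert_nb_flag: "regs s 2 \<noteq> 0 \<Longrightarrow> regs (run (insert_nb e f) s) 2 \<noteq> 0"
  by (simp add: insert_nb_def)

lemma run_insert_nb:
  assumes "reg_lit e" "reg_lit f" "aval f s \<noteq> 0" "holds s N"
  shows "holds (run (insert_nb e f) s) (N(aval e s := add_mset (aval f s) (N (aval e s))))"
proof (cases "regs s 2 = 0")
  case True
  then have N: "stores s N" using assms(4) by (simp add: holds_def)
  show ?thesis
  proof (cases "arrs s 1 (aval e s) \<noteq> 0 \<and> arrs s 2 (aval e s) \<noteq> 0")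
    case True
    then have "size (N (aval e s)) = 2" using N by (simp add: stores_def)
    then show ?thesis using True by (auto simp: holds_def insert_nb_def intro!: exI[of _ "aval e s"])
  next
    case False
    then show ?thesis using True N assms(3) by (auto simp: holds_def insert_nb_def stores_def)
  qed
next
  case False
  then obtain z where "size (N z) > 2" using assms(4) by (auto simp: holds_def)
  then have "size ((N(aval e s := add_mset (aval f s) (N (aval e s)))) z) > 2" by (cases "z = aval e s") simp_all
  then show ?thesis
    unfolding holds_def if_not_P[OF run_insert_nb_flag[OF False]] by (rule exI)
qed

lemma run_delete_nb_frame: "frame {2} s (run (delete_nb e f) s)"
  by (simp add: delete_nb_def frame_def)

lemma run_delete_nb_flag: "regs (run (delete_nb e f) s) 2 = regs s 2"
  by (simp add: delete_nb_def)

lemma run_delete_nb: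
  assumes "reg_lit e" "reg_lit f" "stores s N" "aval f s \<in># N (aval e s)"
  shows "stores (run (delete_nb e f) s) (N(aval e s := N (aval e s) - {#aval f s#}))"
proof -
  define x y where "x = aval e s" and "y = aval f s"
  have N: "N z = filter_mset (\<lambda>x. x \<noteq> 0) {#arrs s 1 z, arrs s 2 z#}"
    and nf: "arrs s 1 z = 0 \<Longrightarrow> arrs s 2 z = 0" for z
    using assms(3) unfolding stores_def by blast+
  have y: "y \<noteq> 0" "arrs s 1 x = y \<or> arrs s 2 x = y"
    using assms(4) N[of x] unfolding x_def y_def by (auto split: if_splits)
  have arrs: "arrs (run (delete_nb e f) s) a z =
    (if z = x \<and> a = 1 then (if arrs s 1 x = y then arrs s 2 x else arrs s 1 x)
     else if z = x \<and> a = 2 then 0 else arrs s a z)" for a z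
    using assms(1) by (simp add: delete_nb_def x_def y_def)
  have "N x - {#y#} = filter_mset (\<lambda>x. x \<noteq> 0)
      {#arrs (run (delete_nb e f) s) 1 x, arrs (run (delete_nb e f) s) 2 x#}"
    using y unfolding arrs N by (elim disjE) simp_all
  then show ?thesis
    unfolding stores_def x_def[symmetric] y_def[symmetric] using N nf by (simp add: arrs)
qed

lemma run_add_edge_frame: "frame {2} s (run (add_edge e f) s)"
  unfolding add_edge_def run.simps using run_insert_nb_frame frame_trans by blast

lemma run_add_edge_flag: "regs s 2 \<noteq> 0 \<Longrightarrow> regs (run (add_edge e f) s) 2 \<noteq> 0"
  unfolding add_edge_def run.simps by (intro run_insert_nb_flag)

lemma run_add_edge:
  assumes "reg_lit e" "reg_lit f" "aval e s = x" "aval f s = y" "x \<noteq> 0" "y \<noteq> 0" "holds s (nbs M)"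
  shows "holds (run (add_edge e f) s) (nbs (add_mset {#x, y#} M))"
proof -
  let ?s = "run (insert_nb e f) s" and ?N = "(nbs M)(x := add_mset y (nbs M x))"
  have "aval e ?s = x" "aval f ?s = y"
    using assms aval_frame run_insert_nb_frame by blast+
  moreover have "holds ?s ?N" using run_insert_nb[of e f s "nbs M"] assms by simp
  ultimately have "holds (run (insert_nb f e) ?s) (?N(y := add_mset x (?N y)))"
    using run_insert_nb[of f e ?s ?N] assms by simp
  moreover have "?N(y := add_mset x (?N y)) = nbs (add_mset {#x, y#} M)" by auto
  ultimately show ?thesis by (simp add: add_edge_def)
qed

lemma run_del_edge_frame: "frame {2} s (run (del_edge e f) s)"
  unfolding del_edge_def run.simps using run_delete_nb_frame frame_trans by blast

lemma run_del_edge_flag: "regs (run (del_edge e f) s) 2 = regs s 2"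
  unfolding del_edge_def run.simps by (simp add: run_delete_nb_flag)

lemma run_del_edge:
  assumes "reg_lit e" "reg_lit f" "aval e s = x" "aval f s = y"
    "stores s (nbs (add_mset {#x, y#} M))"
  shows "stores (run (del_edge e f) s) (nbs M)"
proof -
  let ?s = "run (delete_nb e f) s" and ?M = "add_mset {#x, y#} M"
  let ?N = "(nbs ?M)(x := nbs ?M x - {#y#})"
  have "aval e ?s = x" "aval f ?s = y"
    using assms aval_frame run_delete_nb_frame by blast+
  moreover have "stores ?s ?N" using run_delete_nb[of e f s "nbs ?M"] assms by simp
  ultimately have "stores (run (delete_nb f e) ?s) (?N(y := ?N y - {#x#}))"
    using run_delete_nb[of f e ?s ?N] assms by simp
  moreover have "?N(y := ?N y - {#x#}) = nbs M" by auto
  ultimately show ?thesis by (simp add: del_edge_def)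
qed

lemma stores_deg_le: "stores s (nbs M) \<Longrightarrow> deg M z \<le> 2"
  by (simp add: stores_def)

lemma stores_first: "stores s (nbs M) \<Longrightarrow> arrs s 1 z = 0 \<longleftrightarrow> nbs M z = {#}"
  by (auto simp: stores_def)

text \<open>A third neighbour contradicts \<open>mu_deg_le\<close>; this entitles the machine to
  reject on overflow.\<close>

lemma holds_rejected: "holds s (nbs M) \<Longrightarrow> regs s 2 \<noteq> 0 \<Longrightarrow> wf2 M \<Longrightarrow> \<not> mu M"
  using mu_deg_le by (metis holds_def not_le)

section \<open>Contraction on the machine\<close>

lemma deg_substitute:
  assumes "wf2 T" "a \<noteq> m"
  shows "deg (image_mset (image_mset (\<lambda>z. if z = m then a else z)) T) z =
    (if z = m then 0 else if z = a then deg T a + deg T m else deg T z)"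
  using assms(1)
proof (induction T)
  case (add C T)
  then obtain x y where "C = {#x, y#}" by (auto simp: wf2_def)
  with add assms(2) show ?case by auto
qed simp

lemma substitute_id:
  assumes "wf2 T" "nbs T m = {#}"
  shows "image_mset (image_mset (\<lambda>z. if z = m then a else z)) T = T"
proof -
  have "image_mset (\<lambda>z. if z = m then a else z) C = C" if "C \<in># T" for C
  proof -
    have "m \<notin># C" using assms that nbs_eq_empty_iff by blast
    then have "image_mset (\<lambda>z. if z = m then a else z) C = image_mset (\<lambda>z. z) C"
      by (intro image_mset_cong) auto
    then show ?thesis by simp
  qed
  then show ?thesis using image_mset_cong[of T _ "\<lambda>C. C"] by simp
qed

text \<open>Register 3 holds a literal \<open>l\<close> with the single clause \<open>{l, a}\<close>; then \<open>- l\<close> is replaced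
  by \<open>a\<close> everywhere.  All deletions precede the insertions, so that a third neighbour
  is only reported when the final clause-set has one.\<close>

definition contract :: com where
  "contract =
    Seq (Assign 4 (Load 1 (Reg 3))) (Seq (Assign 5 (Load 1 (Minus (Reg 3))))
    (Seq (Assign 6 (Load 2 (Minus (Reg 3))))
    (If (Eq (Reg 5) (Const 0)) (Assign 2 (Const 1))
    (If (Eq (Reg 4) (Minus (Reg 3))) (Assign 2 (Const 1))
    (Seq (del_edge (Reg 3) (Reg 4))
    (If (Eq (Reg 5) (Minus (Reg 3)))
      (Seq (del_edge (Minus (Reg 3)) (Minus (Reg 3))) (add_edge (Reg 4) (Reg 4)))
    (If (Eq (Reg 6) (Const 0))
      (Seq (del_edge (Minus (Reg 3)) (Reg 5)) (add_edge (Reg 4) (Reg 5)))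
      (Seq (del_edge (Minus (Reg 3)) (Reg 5)) (Seq (del_edge (Minus (Reg 3)) (Reg 6))
      (Seq (add_edge (Reg 4) (Reg 5)) (add_edge (Reg 4) (Reg 6))))))))))))"

text \<open>The claims on degrees are what lets one sweep suffice. The literals \<open>l\<close> and
  \<open>- l\<close> vanish, \<open>a\<close> gives up its place in \<open>{l, a}\<close> but takes
  over at least one clause of \<open>- l\<close>, and no other degree changes; so no literal newly
  gets degree one.\<close>

lemma contract_correct:
  assumes flag: "regs s 2 = 0" and st: "stores s (nbs M)" and M: "wf2 M"
    and deg1: "deg M (regs s 3) = 1"
  defines "s' \<equiv> run contract s"
  shows "frame {2, 4, 5, 6} s s'"
    and "regs s' 2 \<noteq> 0 \<Longrightarrow> \<not> mu M"
    and "regs s' 2 = 0 \<Longrightarrow> \<exists>M'. stores s' (nbs M') \<and> wf2 M' \<and> (mu M \<longleftrightarrow> mu M') \<and>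
      (\<forall>z. nbs M' z \<noteq> {#} \<longrightarrow> nbs M z \<noteq> {#}) \<and> (\<forall>z. deg M z \<noteq> 1 \<longrightarrow> deg M' z \<noteq> 1) \<and>
      deg M' (regs s 3) \<noteq> 1"
proof -
  define l a b c where "l = regs s 3" and "a = arrs s 1 l" and "b = arrs s 1 (- l)" and "c = arrs s 2 (- l)"
  define s0 where "s0 = s\<lparr>regs := (regs s)(4 := a, 5 := b, 6 := c)\<rparr>"
  have N: "nbs M z = filter_mset (\<lambda>x. x \<noteq> 0) {#arrs s 1 z, arrs s 2 z#}"
    and nf: "arrs s 1 z = 0 \<Longrightarrow> arrs s 2 z = 0" for z
    using st unfolding stores_def by blast+
  have s0: "regs s0 2 = 0" "regs s0 3 = l" "regs s0 4 = a" "regs s0 5 = b" "regs s0 6 = c"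
    "arrs s0 = arrs s" "frame {2, 4, 5, 6} s s0"
    using flag by (simp_all add: s0_def l_def frame_def)
  then have st0: "stores s0 (nbs M)" using st by (simp add: stores_def)
  have l: "nbs M l = {#a#}" "a \<noteq> 0"
    using deg1 nf[of l] unfolding l_def[symmetric] N a_def by (auto split: if_splits)
  then have l0: "l \<noteq> 0" using nbs_nonempty_nonzero[OF M] by (metis add_mset_not_empty)
  obtain T where T: "M = add_mset {#l, a#} T" using nbs_obtain[OF M, of a l] l(1) by auto
  \<comment> \<open>A clause \<open>{l, l}\<close> would count twice, against degree one.\<close>
  have "a \<noteq> l" using l(1) T by auto
  then have Tl: "nbs T l = {#}" "wf2 T" using l(1) T M by auto
  let ?rest = "If (Eq (Reg 5) (Minus (Reg 3)))
      (Seq (del_edge (Minus (Reg 3)) (Minus (Reg 3))) (add_edge (Reg 4) (Reg 4)))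
    (If (Eq (Reg 6) (Const 0))
      (Seq (del_edge (Minus (Reg 3)) (Reg 5)) (add_edge (Reg 4) (Reg 5)))
      (Seq (del_edge (Minus (Reg 3)) (Reg 5)) (Seq (del_edge (Minus (Reg 3)) (Reg 6))
      (Seq (add_edge (Reg 4) (Reg 5)) (add_edge (Reg 4) (Reg 6))))))"
  have s': "s' = (if b = 0 \<or> a = - l then s0\<lparr>regs := (regs s0)(2 := 1)\<rparr>
      else run ?rest (run (del_edge (Reg 3) (Reg 4)) s0))"
    unfolding s'_def contract_def s0_def a_def b_def c_def l_def by (simp add: fun_upd_twist)
  have "frame {2, 4, 5, 6} s s' \<and> (if regs s' 2 \<noteq> 0 then \<not> mu M
    else \<exists>M'. stores s' (nbs M') \<and> wf2 M' \<and> (mu M \<longleftrightarrow> mu M') \<and>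
      (\<forall>z. nbs M' z \<noteq> {#} \<longrightarrow> nbs M z \<noteq> {#}) \<and> (\<forall>z. deg M z \<noteq> 1 \<longrightarrow> deg M' z \<noteq> 1) \<and>
      deg M' (regs s 3) \<noteq> 1)"
  proof (cases "b = 0 \<or> a = - l")
    case True
    have "\<not> mu M"
    proof
      assume mu: "mu M"
      have "{#l, a#} \<in># M" using T by simp
      with mu have "a \<noteq> - l" using mu_no_taut M by blast
      moreover have "b \<noteq> 0" using mu_compl_occurs[OF mu M, of l] l(1) stores_first[OF st, of "- l"]
        by (simp add: b_def)
      ultimately show False using True by blast
    qed
    then show ?thesis using True s' s0(7) by (simp add: frame_def)
  next
    case False
    then have ab: "b \<noteq> 0" "a \<noteq> - l" by auto
    let ?s1 = "run (del_edge (Reg 3) (Reg 4)) s0"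
    have f1: "frame {2} s0 ?s1" by (rule run_del_edge_frame)
    have st1: "stores ?s1 (nbs T)"
      by (rule run_del_edge[where x=l and y=a]) (use s0 st0 T in simp_all)
    have fl1: "regs ?s1 2 = 0" using s0 by (simp add: run_del_edge_flag)
    have r1: "regs ?s1 3 = l" "regs ?s1 4 = a" "regs ?s1 5 = b" "regs ?s1 6 = c"
      using f1 s0 by (simp_all add: frame_def)
    have s'1: "s' = run ?rest ?s1" using s' False by simp
    have NT: "nbs T (- l) = filter_mset (\<lambda>x. x \<noteq> 0) {#b, c#}"
      using N[of "- l"] T ab l0 unfolding b_def c_def by simp
    let ?M' = "image_mset (image_mset (\<lambda>z. if z = - l then a else z)) T"
    have main: "frame {2} ?s1 s' \<and> holds s' (nbs ?M') \<and> wf2 ?M'"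
    \<comment> \<open>A clause \<open>{- l, - l}\<close> fills both places of \<open>- l\<close>, so
      inspecting the first place is enough, and no other clause contains \<open>- l\<close>.\<close>
    proof (cases "b = - l")
      case True
      obtain R where R: "T = add_mset {#- l, - l#} R"
        using nbs_obtain[OF Tl(2), of b "- l"] NT ab True by auto
      then have "size (nbs T (- l)) = 2 + deg R (- l)" by simp
      moreover have "size (nbs T (- l)) \<le> 2" using NT by simp
      ultimately have R0: "nbs R (- l) = {#}" "wf2 R" using R Tl(2) by auto
      have M': "?M' = add_mset {#a, a#} R" using R substitute_id[OF R0(2,1)] by simp
      let ?s2 = "run (del_edge (Minus (Reg 3)) (Minus (Reg 3))) ?s1"
      have f2: "frame {2} ?s1 ?s2" by (rule run_del_edge_frame)
      have "stores ?s2 (nbs R)"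
        by (rule run_del_edge[where x="- l" and y="- l"]) (use r1 st1 R in simp_all)
      then have h2: "holds ?s2 (nbs R)" using fl1 by (simp add: holds_def run_del_edge_flag)
      have r2: "regs ?s2 4 = a" using f2 r1 by (simp add: frame_def)
      have s'2: "s' = run (add_edge (Reg 4) (Reg 4)) ?s2" using s'1 r1 True by simp
      have "holds s' (nbs ?M')"
        unfolding M' s'2 by (rule run_add_edge) (use r2 h2 l(2) in simp_all)
      moreover have "frame {2} ?s1 s'"
        unfolding s'2 by (rule frame_trans[OF f2 run_add_edge_frame])
      ultimately show ?thesis using M' R0(2) l(2) by simp
    next
      case bl: False
      obtain R1 where R1: "T = add_mset {#- l, b#} R1"
        using nbs_obtain[OF Tl(2), of b "- l"] NT ab by auto
      then have NR1: "nbs R1 (- l) = filter_mset (\<lambda>x. x \<noteq> 0) {#c#}" "wf2 R1"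
        using NT ab bl Tl(2) by (auto split: if_splits)
      let ?s2 = "run (del_edge (Minus (Reg 3)) (Reg 5)) ?s1"
      have f2: "frame {2} ?s1 ?s2" by (rule run_del_edge_frame)
      have st2: "stores ?s2 (nbs R1)"
        by (rule run_del_edge[where x="- l" and y=b]) (use r1 st1 R1 in simp_all)
      have fl2: "regs ?s2 2 = 0" using fl1 by (simp add: run_del_edge_flag)
      have r2: "regs ?s2 3 = l" "regs ?s2 4 = a" "regs ?s2 5 = b" "regs ?s2 6 = c"
        using f2 r1 by (simp_all add: frame_def)
      show ?thesis
      proof (cases "c = 0")
        case True
        have M': "?M' = add_mset {#a, b#} R1"
          using R1 substitute_id[OF NR1(2)] NR1(1) True bl by simp
        have s'2: "s' = run (add_edge (Reg 4) (Reg 5)) ?s2" using s'1 r1 True bl by simp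
        have h2: "holds ?s2 (nbs R1)" using st2 fl2 by (simp add: holds_def)
        have "holds s' (nbs ?M')"
          unfolding M' s'2 by (rule run_add_edge) (use r2 h2 l(2) ab in simp_all)
        moreover have "frame {2} ?s1 s'"
          unfolding s'2 by (rule frame_trans[OF f2 run_add_edge_frame])
        ultimately show ?thesis using M' NR1(2) l(2) ab by simp
      next
        case False
        obtain R where R: "R1 = add_mset {#- l, c#} R"
          using nbs_obtain[OF NR1(2), of c "- l"] NR1(1) False by auto
        then have cl: "c \<noteq> - l" using NR1(1) False by (auto split: if_splits)
        then have R0: "nbs R (- l) = {#}" "wf2 R" using R NR1 False by auto
        have M': "?M' = add_mset {#a, c#} (add_mset {#a, b#} R)"
          using R1 R substitute_id[OF R0(2,1)] bl cl by simp
        let ?s3 = "run (del_edge (Minus (Reg 3)) (Reg 6)) ?s2"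
        have f3: "frame {2} ?s2 ?s3" by (rule run_del_edge_frame)
        have "stores ?s3 (nbs R)"
          by (rule run_del_edge[where x="- l" and y=c]) (use r2 st2 R in simp_all)
        then have h3: "holds ?s3 (nbs R)" using fl2 by (simp add: holds_def run_del_edge_flag)
        have r3: "regs ?s3 4 = a" "regs ?s3 5 = b" "regs ?s3 6 = c"
          using f3 r2 by (simp_all add: frame_def)
        let ?s4 = "run (add_edge (Reg 4) (Reg 5)) ?s3"
        have f4: "frame {2} ?s3 ?s4" by (rule run_add_edge_frame)
        \<comment> \<open>This insertion may overflow; \<open>holds\<close> carries the argument
          through with register 2 raised.\<close>
        have h4: "holds ?s4 (nbs (add_mset {#a, b#} R))"
          by (rule run_add_edge) (use r3 h3 l(2) ab in simp_all)
        have r4: "regs ?s4 4 = a" "regs ?s4 6 = c"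
          using f4 r3 by (simp_all add: frame_def)
        have s'2: "s' = run (add_edge (Reg 4) (Reg 6)) ?s4" using s'1 r1 False bl by simp
        have "holds s' (nbs ?M')"
          unfolding M' s'2 by (rule run_add_edge) (use r4 h4 l(2) False in simp_all)
        moreover have "frame {2} ?s1 s'"
          unfolding s'2
          by (rule frame_trans[OF frame_trans[OF frame_trans[OF f2 f3] f4] run_add_edge_frame])
        ultimately show ?thesis using M' R0(2) l(2) ab False by simp
      qed
    qed
    obtain C0 where C0: "C0 \<in># T" "- l \<in># C0"
      using NT ab nbs_eq_empty_iff[OF Tl(2), of "- l"] by auto
    have "\<forall>C\<in>#T. l \<notin># C" using Tl nbs_eq_empty_iff by blast
    then have mu: "mu M \<longleftrightarrow> mu ?M'"
      unfolding T using mu_substitute[OF Tl(2) \<open>a \<noteq> l\<close> ab(2) l0 _ C0] by blast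
    have degT: "deg T (- l) > 0" using NT ab by simp
    have degM: "deg M z = deg T z + (if z = l then 1 else 0) + (if z = a then 1 else 0)" for z
      using T by simp
    have deg': "deg ?M' z = (if z = - l then 0 else if z = a then deg T a + deg T (- l) else deg T z)" for z
      by (rule deg_substitute[OF Tl(2) ab(2)])
    have occ: "nbs M z \<noteq> {#}" if "nbs ?M' z \<noteq> {#}" for z
    proof -
      have "deg ?M' z > 0" using that by (simp add: nonempty_has_size)
      then have "deg M z > 0" using deg' degM by (auto split: if_splits)
      then show ?thesis by (simp add: nonempty_has_size)
    qed
    have "deg ?M' z \<noteq> 1" if "deg M z \<noteq> 1" for z
    proof (cases "z = a")
      case True
      have "deg M z = deg T a + 1" using degM[of z] True \<open>a \<noteq> l\<close> by simp
      moreover have "deg ?M' z = deg T a + deg T (- l)" using deg'[of z] True ab by simp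
      ultimately show ?thesis using that degT by linarith
    next
      case False
      then show ?thesis using that deg'[of z] degM[of z] Tl(1) by (auto split: if_splits)
    qed
    moreover have "deg ?M' l \<noteq> 1" using deg'[of l] \<open>a \<noteq> l\<close> Tl(1) by (auto split: if_splits)
    moreover have "frame {2, 4, 5, 6} s s'"
    proof -
      have "frame {2} s0 s'" using frame_trans[OF f1] main by blast
      then have "frame {2, 4, 5, 6} s0 s'" by (rule frame_mono) simp
      then show ?thesis by (rule frame_trans[OF s0(7)])
    qed
    ultimately show ?thesis
      using main mu occ holds_rejected[of s' ?M'] by (auto simp: holds_def l_def)
  qed
  then show "frame {2, 4, 5, 6} s s'"
    and "regs s' 2 \<noteq> 0 \<Longrightarrow> \<not> mu M"
    and "regs s' 2 = 0 \<Longrightarrow> \<exists>M'. stores s' (nbs M') \<and> wf2 M' \<and> (mu M \<longleftrightarrow> mu M') \<and>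
      (\<forall>z. nbs M' z \<noteq> {#} \<longrightarrow> nbs M z \<noteq> {#}) \<and> (\<forall>z. deg M z \<noteq> 1 \<longrightarrow> deg M' z \<noteq> 1) \<and>
      deg M' (regs s 3) \<noteq> 1"
    by simp_all
qed

text \<open>Register 3 holds a literal \<open>x\<close>.  When \<open>x\<close> is equivalent to each of two literals \<open>p\<close>, \<open>q\<close>, these
  equivalences are replaced by that of \<open>p\<close> and \<open>q\<close>.  Register 7 becomes 1 when the
  contradiction between \<open>x\<close> and \<open>- x\<close> has been found and removed; nothing else may remain then.\<close>

definition relink :: com where
  "relink =
    If (Eq (Reg 4) (Minus (Reg 3)))
      (Seq (del_edge (Reg 3) (Reg 3)) (Seq (del_edge (Minus (Reg 3)) (Minus (Reg 3)))
        (Assign 7 (Const 1))))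
      (Seq (del_edge (Minus (Reg 3)) (Reg 4)) (Seq (del_edge (Minus (Reg 3)) (Reg 5))
      (Seq (del_edge (Reg 3) (Minus (Reg 4))) (Seq (del_edge (Reg 3) (Minus (Reg 5)))
      (Seq (add_edge (Reg 5) (Minus (Reg 4))) (add_edge (Reg 4) (Minus (Reg 5))))))))"

text \<open>The tests are the conclusion of \<open>mu_saturated_nbs\<close>, for both orders in
  which the arrays may list the neighbours. The first two exclude tautologies.\<close>

definition checked_relink :: com where
  "checked_relink =
    If (Eq (Reg 4) (Reg 3)) (Assign 2 (Const 1))
    (If (Eq (Reg 5) (Reg 3)) (Assign 2 (Const 1))
    (If (And (Eq (Load 1 (Reg 3)) (Minus (Reg 4))) (Eq (Load 2 (Reg 3)) (Minus (Reg 5)))) relink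
    (If (And (Eq (Load 1 (Reg 3)) (Minus (Reg 5))) (Eq (Load 2 (Reg 3)) (Minus (Reg 4)))) relink
      (Assign 2 (Const 1)))))"

text \<open>Meant for literals that still occur: once register 7 says that the contradiction has
  been removed, a leftover clause is a reason to reject.\<close>

definition eliminate :: com where
  "eliminate =
    If (Eq (Reg 7) (Const 0))
      (Seq (Assign 4 (Load 1 (Minus (Reg 3)))) (Seq (Assign 5 (Load 2 (Minus (Reg 3)))) checked_relink))
      (Assign 2 (Const 1))"

text \<open>Failed tests contradict \<open>mu_saturated_nbs\<close>. Passed tests exhibit the
  clauses in \<open>M\<close>, so that \<open>mu_eliminate\<close> or \<open>mu_terminal\<close>
  applies whether or not \<open>M\<close> is minimally unsatisfiable. In the former case each of
  \<open>p\<close>, \<open>q\<close>, \<open>- p\<close>, \<open>- q\<close> loses one occurrence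
  and gains one, which preserves saturation.\<close>

lemma eliminate_correct:
  assumes flag: "regs s 2 = 0" and st: "stores s (nbs M)" and M: "wf2 M" "saturated M"
    and x: "nbs M (regs s 3) \<noteq> {#}" and ans: "regs s 7 = 0"
  defines "s' \<equiv> run eliminate s"
  shows "frame {2, 4, 5, 7} s s' \<and> (if regs s' 2 \<noteq> 0 then \<not> mu M
    else \<exists>M'. stores s' (nbs M') \<and> wf2 M' \<and> saturated M' \<and>
      (\<forall>z. nbs M' z \<noteq> {#} \<longrightarrow> nbs M z \<noteq> {#}) \<and> nbs M' (regs s 3) = {#} \<and>
      (regs s' 7 = 0 \<and> (mu M \<longleftrightarrow> mu M') \<or> regs s' 7 = 1 \<and> (mu M \<longleftrightarrow> M' = {#})))"
    (is "_ \<and> ?res")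
proof -
  define x p q a b where "x = regs s 3" and "p = arrs s 1 (- x)" and "q = arrs s 2 (- x)"
    and "a = arrs s 1 x" and "b = arrs s 2 x"
  define s0 where "s0 = s\<lparr>regs := (regs s)(4 := p, 5 := q)\<rparr>"
  have N: "nbs M z = filter_mset (\<lambda>x. x \<noteq> 0) {#arrs s 1 z, arrs s 2 z#}" for z
    using st unfolding stores_def by blast
  have s0: "regs s0 2 = 0" "regs s0 3 = x" "regs s0 4 = p" "regs s0 5 = q" "regs s0 7 = 0"
    "arrs s0 = arrs s" "frame {2, 4, 5, 7} s s0"
    using flag ans by (simp_all add: s0_def x_def frame_def)
  then have st0: "stores s0 (nbs M)" using st by (simp add: stores_def)
  have x0: "x \<noteq> 0" using x nbs_nonempty_nonzero[OF M(1)] by (simp add: x_def)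
  have "deg M x = 2" using saturatedD[OF M(2) x] by (simp add: x_def)
  then have ab: "a \<noteq> 0" "b \<noteq> 0" "nbs M x = {#a, b#}"
    using N[of x] unfolding a_def[symmetric] b_def[symmetric] by (auto split: if_splits)
  define local_ok where "local_ok \<longleftrightarrow> p \<noteq> x \<and> q \<noteq> x \<and> (a = - p \<and> b = - q \<or> a = - q \<and> b = - p)"
  have ifs: "(if A then u else if B then u else if C then v else if D then v else u) =
      (if \<not> A \<and> \<not> B \<and> (C \<or> D) then v else u)" for A B C D and u v :: state
    by simp
  have "s' = run checked_relink s0"
    unfolding s'_def eliminate_def s0_def p_def q_def x_def using ans by simp
  also have "\<dots> = (if local_ok then run relink s0 else s0\<lparr>regs := (regs s0)(2 := 1)\<rparr>)"
    unfolding checked_relink_def run.simps bval.simps aval.simps s0 local_ok_def a_def b_def by (rule ifs)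
  finally have s': "s' = (if local_ok then run relink s0 else s0\<lparr>regs := (regs s0)(2 := 1)\<rparr>)" .
  show ?thesis
  proof (cases local_ok)
    case False
    have "\<not> mu M"
    proof
      assume "mu M"
      then obtain p' q' where pq': "nbs M (- x) = {#p', q'#}" "nbs M x = {#- p', - q'#}" "p' \<noteq> x" "q' \<noteq> x"
        using mu_saturated_nbs[OF _ M] x unfolding x_def by metis
      then have "p \<noteq> 0" "q \<noteq> 0"
        using N[of "- x"] unfolding p_def[symmetric] q_def[symmetric] by (auto split: if_splits)
      then have "{#p', q'#} = {#p, q#}"
        using N[of "- x"] pq'(1) unfolding p_def[symmetric] q_def[symmetric] by simp
      moreover have "{#- p', - q'#} = {#a, b#}" using ab pq'(2) by simp
      ultimately have local_ok using pq'(3,4) unfolding local_ok_def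
        by (auto simp: add_eq_conv_ex)
      with False show False by simp
    qed
    then show ?thesis using False s' s0(7) by (simp add: frame_def)
  next
    case True
    then have ok: "p \<noteq> x" "q \<noteq> x" and nbs_x: "nbs M x = {#- p, - q#}" and pq0: "p \<noteq> 0" "q \<noteq> 0"
      using ab unfolding local_ok_def by (auto simp: add_mset_commute)
    have s'1: "s' = run relink s0" using True s' by simp
    have nbs_mx: "nbs M (- x) = {#p, q#}"
      using N[of "- x"] pq0 unfolding p_def[symmetric] q_def[symmetric] by simp
    show ?thesis
    \<comment> \<open>A clause \<open>{- x, - x}\<close> fills both places and forces
      \<open>q = - x\<close>; this is the situation of \<open>mu_terminal\<close>.\<close>
    proof (cases "p = - x")
      case True
      obtain M1 where M1: "M = add_mset {#- x, - x#} M1"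
        using nbs_obtain[OF M(1), of p "- x"] nbs_mx True by auto
      then have M1': "nbs M1 (- x) = {#}" "q = - x" "nbs M1 x = {#x, x#}" "wf2 M1"
        using nbs_mx nbs_x x0 True M(1) by (auto split: if_splits)
      obtain R where R: "M1 = add_mset {#x, x#} R"
        using nbs_obtain[OF M1'(4), of x x] M1'(3) by auto
      have R0: "nbs R x = {#}" "nbs R (- x) = {#}" "wf2 R"
        using R M1' x0 by auto
      let ?s1 = "run (del_edge (Reg 3) (Reg 3)) s0"
      have f1: "frame {2} s0 ?s1" by (rule run_del_edge_frame)
      have st1: "stores ?s1 (nbs (add_mset {#- x, - x#} R))"
        by (rule run_del_edge[where x=x and y=x])
          (use s0 st0 M1 R in \<open>simp_all add: add_mset_commute\<close>)
      have r1: "regs ?s1 3 = x" "regs ?s1 7 = 0" using f1 s0 by (simp_all add: frame_def)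
      let ?s2 = "run (del_edge (Minus (Reg 3)) (Minus (Reg 3))) ?s1"
      have f2: "frame {2} ?s1 ?s2" by (rule run_del_edge_frame)
      have st2: "stores ?s2 (nbs R)"
        by (rule run_del_edge[where x="- x" and y="- x"]) (use r1 st1 in simp_all)
      have s'2: "s' = ?s2\<lparr>regs := (regs ?s2)(7 := 1)\<rparr>" using s'1 s0 True by (simp add: relink_def)
      have "frame {2, 4, 5, 7} s0 ?s2"
        using frame_mono[OF frame_trans[OF f1 f2], of "{2, 4, 5, 7}"] by simp
      then have "frame {2, 4, 5, 7} s s'"
        using frame_trans[OF s0(7)] unfolding s'2 by (simp add: frame_def)
      moreover have "regs s' 2 = 0" using s'2 s0(1) by (simp add: run_del_edge_flag)
      moreover have "stores s' (nbs R)" using st2 unfolding s'2 stores_def by simp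
      moreover have "mu M \<longleftrightarrow> R = {#}"
        using mu_terminal[OF x0, of R] M1 R by (simp add: add_mset_commute)
      moreover have occ: "nbs M z = (if z = x then {#x, x#} else if z = - x then {#- x, - x#} else nbs R z)" for z
        using M1 R R0 x0 by simp
      moreover have "saturated R"
        unfolding saturated_def
      proof (intro allI impI)
        fix z assume "nbs R z \<noteq> {#}"
        then have "z \<noteq> x" "z \<noteq> - x" using R0 by auto
        then show "deg R z = 2" using saturatedD[OF M(2), of z] \<open>nbs R z \<noteq> {#}\<close> occ[of z] by simp
      qed
      moreover have "\<forall>z. nbs R z \<noteq> {#} \<longrightarrow> nbs M z \<noteq> {#}" using occ R0 by auto
      moreover have "regs s' 7 = 1" using s'2 by simp
      ultimately show ?thesis using R0 unfolding x_def by auto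
    next
      case px: False
      obtain M1 where M1: "M = add_mset {#- x, p#} M1"
        using nbs_obtain[OF M(1), of p "- x"] nbs_mx by auto
      have M1': "nbs M1 (- x) = {#q#}" "nbs M1 x = {#- p, - q#}" "wf2 M1"
        using M1 nbs_mx nbs_x x0 px ok M(1) by auto
      \<comment> \<open>Otherwise \<open>{- x, - x}\<close> would account for both neighbours of
        \<open>- x\<close>, and \<open>p\<close> would be \<open>- x\<close> too.\<close>
      have qx: "q \<noteq> - x"
      proof
        assume q: "q = - x"
        then obtain R' where "M1 = add_mset {#- x, - x#} R'"
          using nbs_obtain[OF M1'(3), of q "- x"] M1'(1) by auto
        then show False using M1'(1) by simp
      qed
      obtain M2 where M2: "M1 = add_mset {#- x, q#} M2"
        using nbs_obtain[OF M1'(3), of q "- x"] M1' by auto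
      have M2': "nbs M2 (- x) = {#}" "nbs M2 x = {#- p, - q#}" "wf2 M2"
        using M2 M1' x0 qx ok by auto
      obtain M3 where M3: "M2 = add_mset {#x, - p#} M3"
        using nbs_obtain[OF M2'(3), of "- p" x] M2' by auto
      have px': "- p \<noteq> x" "- q \<noteq> x" using px qx by auto
      have M3': "nbs M3 (- x) = {#}" "nbs M3 x = {#- q#}" "wf2 M3"
        using M3 M2' x0 px' ok by auto
      obtain R where R: "M3 = add_mset {#x, - q#} R"
        using nbs_obtain[OF M3'(3), of "- q" x] M3' by auto
      have R0: "nbs R (- x) = {#}" "nbs R x = {#}" "wf2 R"
        using R M3' x0 px' ok by auto
      let ?M' = "add_mset {#p, - q#} (add_mset {#q, - p#} R)"
      have wf': "wf2 ?M'" using R0 pq0 by simp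
      have "\<forall>C\<in>#R. x \<notin># C \<and> - x \<notin># C" using R0 nbs_eq_empty_iff by blast
      then have "mu (R + {#{#- x, p#}, {#- x, q#}, {#x, - p#}, {#x, - q#}#}) \<longleftrightarrow>
          mu (R + {#{#p, - q#}, {#q, - p#}#})"
        using mu_eliminate[OF x0 ok(1) px ok(2) qx pq0] by blast
      moreover have "R + {#{#- x, p#}, {#- x, q#}, {#x, - p#}, {#x, - q#}#} = M"
        unfolding M1 M2 M3 R by simp
      ultimately have mu: "mu M \<longleftrightarrow> mu ?M'" by simp
      let ?s1 = "run (del_edge (Minus (Reg 3)) (Reg 4)) s0"
      have f1: "frame {2} s0 ?s1" by (rule run_del_edge_frame)
      have st1: "stores ?s1 (nbs M1)"
        by (rule run_del_edge[where x="- x" and y=p]) (use s0 st0 M1 in simp_all)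
      have r1: "regs ?s1 3 = x" "regs ?s1 4 = p" "regs ?s1 5 = q" "regs ?s1 2 = 0"
        using f1 s0 by (simp_all add: frame_def run_del_edge_flag)
      let ?s2 = "run (del_edge (Minus (Reg 3)) (Reg 5)) ?s1"
      have f2: "frame {2} ?s1 ?s2" by (rule run_del_edge_frame)
      have st2: "stores ?s2 (nbs M2)"
        by (rule run_del_edge[where x="- x" and y=q]) (use r1 st1 M2 in simp_all)
      have r2: "regs ?s2 3 = x" "regs ?s2 4 = p" "regs ?s2 5 = q" "regs ?s2 2 = 0"
        using f2 r1 by (simp_all add: frame_def run_del_edge_flag)
      let ?s3 = "run (del_edge (Reg 3) (Minus (Reg 4))) ?s2"
      have f3: "frame {2} ?s2 ?s3" by (rule run_del_edge_frame)
      have st3: "stores ?s3 (nbs M3)"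
        by (rule run_del_edge[where x=x and y="- p"]) (use r2 st2 M3 in simp_all)
      have r3: "regs ?s3 3 = x" "regs ?s3 4 = p" "regs ?s3 5 = q" "regs ?s3 2 = 0"
        using f3 r2 by (simp_all add: frame_def run_del_edge_flag)
      let ?s4 = "run (del_edge (Reg 3) (Minus (Reg 5))) ?s3"
      have f4: "frame {2} ?s3 ?s4" by (rule run_del_edge_frame)
      have st4: "stores ?s4 (nbs R)"
        by (rule run_del_edge[where x=x and y="- q"]) (use r3 st3 R in simp_all)
      have r4: "regs ?s4 4 = p" "regs ?s4 5 = q" "regs ?s4 2 = 0"
        using f4 r3 by (simp_all add: frame_def run_del_edge_flag)
      let ?s5 = "run (add_edge (Reg 5) (Minus (Reg 4))) ?s4"
      have f5: "frame {2} ?s4 ?s5" by (rule run_add_edge_frame)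
      have h4: "holds ?s4 (nbs R)" using st4 r4 by (simp add: holds_def)
      have h5: "holds ?s5 (nbs (add_mset {#q, - p#} R))"
        by (rule run_add_edge) (use r4 h4 pq0 in simp_all)
      have r5: "regs ?s5 4 = p" "regs ?s5 5 = q" using f5 r4 by (simp_all add: frame_def)
      have s'2: "s' = run (add_edge (Reg 4) (Minus (Reg 5))) ?s5" using s'1 s0 px by (simp add: relink_def)
      have f6: "frame {2} ?s5 s'" unfolding s'2 by (rule run_add_edge_frame)
      have h6: "holds s' (nbs ?M')"
        unfolding s'2 by (rule run_add_edge) (use r5 h5 pq0 in simp_all)
      have f06: "frame {2} s0 s'"
        by (rule frame_trans[OF frame_trans[OF frame_trans[OF frame_trans[OF frame_trans[OF f1 f2] f3] f4] f5] f6])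
      then have "frame {2, 4, 5, 7} s s'"
        using frame_trans[OF s0(7) frame_mono[OF f06, of "{2, 4, 5, 7}"]] by simp
      moreover have "regs s' 7 = 0" using f06 s0(5) by (simp add: frame_def)
      moreover have gone: "nbs ?M' x = {#}" "nbs ?M' (- x) = {#}" using R0 ok px' px qx by auto
      have degM': "deg ?M' z = deg M z" if "z \<noteq> x" "z \<noteq> - x" for z
        using that unfolding M1 M2 M3 R by simp
      have occ: "nbs M z \<noteq> {#} \<and> deg ?M' z = 2" if "nbs ?M' z \<noteq> {#}" for z
      proof -
        have d: "deg ?M' z = deg M z" using that gone by (intro degM') metis+
        moreover have "deg ?M' z \<noteq> 0" using that by (simp only: size_eq_0_iff_empty not_False_eq_True)
        ultimately have "nbs M z \<noteq> {#}" by (metis size_eq_0_iff_empty)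
        then show ?thesis using saturatedD[OF M(2)] d by metis
      qed
      then have "saturated ?M'" unfolding saturated_def by blast
      moreover have "\<not> mu M" if "regs s' 2 \<noteq> 0"
        using holds_rejected[OF h6 that wf'] mu by blast
      moreover have "stores s' (nbs ?M')" if "regs s' 2 = 0"
        using h6 that by (simp only: holds_def if_True)
      ultimately show ?thesis using wf' mu occ gone(1) unfolding x_def by (metis (lifting))
    qed
  qed
qed

section \<open>Reading the input\<close>

definition input :: "int list \<Rightarrow> nat \<Rightarrow> state \<Rightarrow> bool" where
  "input w i s \<longleftrightarrow> regs s 0 = int (length w) \<and> regs s 1 = int i \<and>
     (\<forall>j<length w. arrs s 0 (int j) = w ! j)"

lemma input_frame:
  "input w i s \<Longrightarrow> frame R s s' \<Longrightarrow> 0 \<notin> R \<Longrightarrow> 1 \<notin> R \<Longrightarrow> input w i s'"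
  by (simp add: input_def frame_def)

abbreviation advance :: com where
  "advance \<equiv> Assign 1 (AddC (Reg 1) 1)"

lemma input_advance: "input w i s \<Longrightarrow> input w (Suc i) (run advance s)"
  by (simp add: input_def)

lemma input_fetch:
  "input w i s \<Longrightarrow> i < length w \<Longrightarrow> arrs s 0 (regs s 1) = w ! i"
  by (simp add: input_def)

text \<open>Zero can mark an unread place because no literal has code 0. A unit clause is completed
  by repeating its literal, and the flag records an empty clause.\<close>

fun parse_step :: "int \<Rightarrow> int \<times> int \<times> int multiset multiset \<times> bool \<Rightarrow> int \<times> int \<times> int multiset multiset \<times> bool" where
  "parse_step x (u, v, M, bad) =
    (if x \<noteq> 0 then (if u = 0 then (x, v, M, bad) else (u, x, M, bad))
     else if u = 0 then (u, v, M, True)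
     else (0, 0, add_mset {#u, if v = 0 then u else v#} M, bad))"

text \<open>Registers 4 and 5 hold the literals of the clause being read.\<close>

definition parse :: com where
  "parse = Seq (Assign 3 (Load 0 (Reg 1)))
    (If (Eq (Reg 3) (Const 0))
      (If (Eq (Reg 4) (Const 0)) (Assign 2 (Const 1))
        (Seq (If (Eq (Reg 5) (Const 0)) (Assign 5 (Reg 4)) Skip)
        (Seq (add_edge (Reg 4) (Reg 5)) (Seq (Assign 4 (Const 0)) (Assign 5 (Const 0))))))
      (If (Eq (Reg 4) (Const 0)) (Assign 4 (Reg 3)) (Assign 5 (Reg 3))))"

definition parsed :: "int list \<Rightarrow> nat \<Rightarrow> state \<Rightarrow> bool" where
  "parsed w i s \<longleftrightarrow> input w i s \<and> regs s 7 = 0 \<and>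
    (\<exists>M bad. fold parse_step (take i w) (0, 0, {#}, False) = (regs s 4, regs s 5, M, bad) \<and> wf2 M \<and>
      (if bad then regs s 2 \<noteq> 0 else holds s (nbs M)))"

lemma holds_cong:
  "regs s 2 = regs s' 2 \<Longrightarrow> arrs s = arrs s' \<Longrightarrow> holds s N \<longleftrightarrow> holds s' N"
  by (simp add: holds_def stores_def)

lemma parse_correct:
  assumes s: "arrs s 0 (regs s 1) = x" "regs s 4 = u" "regs s 5 = v"
    and wf: "wf2 M" and h: "if bad then regs s 2 \<noteq> 0 else holds s (nbs M)"
    and s': "s' = run parse s"
  shows "frame {2, 3, 4, 5} s s' \<and>
    (\<exists>M' bad'. parse_step x (u, v, M, bad) = (regs s' 4, regs s' 5, M', bad') \<and> wf2 M' \<and>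
      (if bad' then regs s' 2 \<noteq> 0 else holds s' (nbs M')))"
proof -
  consider (lit) "x \<noteq> 0" | (empty) "x = 0" "u = 0" | (clause) "x = 0" "u \<noteq> 0" by blast
  then show ?thesis
  proof cases
    case lit
    then have e: "s' = s\<lparr>regs := (regs s)(3 := x, (if u = 0 then 4 else 5) := x)\<rparr>"
      unfolding s' parse_def using s by simp
    have "holds s' (nbs M) \<longleftrightarrow> holds s (nbs M)" by (rule holds_cong) (simp_all add: e)
    then show ?thesis using lit wf h s by (simp add: e frame_def)
  next
    case empty
    then have e: "s' = s\<lparr>regs := (regs s)(3 := x, 2 := 1)\<rparr>"
      unfolding s' parse_def using s by simp
    then show ?thesis using empty wf s by (auto simp: frame_def)
  next
    case clause
    define v' where "v' = (if v = 0 then u else v)"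
    define s1 where "s1 = s\<lparr>regs := (regs s)(3 := x, 5 := v')\<rparr>"
    let ?s2 = "run (add_edge (Reg 4) (Reg 5)) s1"
    have e: "s' = ?s2\<lparr>regs := (regs ?s2)(4 := 0, 5 := 0)\<rparr>"
      unfolding s' parse_def using s clause
      by (cases "v = 0") (simp_all add: s1_def v'_def fun_upd_idem)
    have s1: "regs s1 4 = u" "regs s1 5 = v'" "v' \<noteq> 0" "regs s1 2 = regs s 2"
      using clause s by (simp_all add: s1_def v'_def)
    have f: "frame {2} s1 ?s2" by (rule run_add_edge_frame)
    have "frame {2, 3, 4, 5} s s'"
      using f unfolding e s1_def by (auto simp: frame_def)
    moreover have "regs s' 2 \<noteq> 0" if bad
      using run_add_edge_flag[of s1] s1 h that by (simp add: e)
    moreover have "holds s' (nbs (add_mset {#u, v'#} M))" if "\<not> bad"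
    proof -
      have "holds s1 (nbs M)" using holds_cong[of s1 s] h that by (simp add: s1_def)
      then have "holds ?s2 (nbs (add_mset {#u, v'#} M))"
        by (intro run_add_edge) (use s1 clause in simp_all)
      moreover have "holds s' N \<longleftrightarrow> holds ?s2 N" for N by (rule holds_cong) (simp_all add: e)
      ultimately show ?thesis by simp
    qed
    ultimately show ?thesis
      using clause wf s1 by (simp add: e v'_def[symmetric])
  qed
qed

lemma parsed_step:
  assumes "parsed w i s" "i < length w"
  shows "parsed w (Suc i) (run (Seq parse advance) s)"
proof -
  obtain M bad where inp: "input w i s" and s7: "regs s 7 = 0" and wf: "wf2 M"
    and f: "fold parse_step (take i w) (0, 0, {#}, False) = (regs s 4, regs s 5, M, bad)"
    and h: "if bad then regs s 2 \<noteq> 0 else holds s (nbs M)"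
    using assms(1) unfolding parsed_def by blast
  let ?s' = "run parse s"
  have f': "fold parse_step (take (Suc i) w) (0, 0, {#}, False) =
      parse_step (w ! i) (regs s 4, regs s 5, M, bad)"
    using assms(2) f by (simp add: take_Suc_conv_app_nth)
  from parse_correct[OF input_fetch[OF inp assms(2)] refl refl wf h refl]
  obtain M' bad' where fr: "frame {2, 3, 4, 5} s ?s'" and wf': "wf2 M'"
    and st: "parse_step (w ! i) (regs s 4, regs s 5, M, bad) = (regs ?s' 4, regs ?s' 5, M', bad')"
    and h': "if bad' then regs ?s' 2 \<noteq> 0 else holds ?s' (nbs M')"
    by blast
  have "input w (Suc i) (run (Seq parse advance) s)"
    using input_advance[OF input_frame[OF inp fr]] by simp
  moreover have "holds (run advance ?s') N \<longleftrightarrow> holds ?s' N" for N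
    by (rule holds_cong) simp_all
  moreover have "regs ?s' 7 = 0" using fr s7 by (simp add: frame_def)
  ultimately show ?thesis
    unfolding parsed_def f' st using wf' h' by simp
qed

section \<open>Clause lists and their coded multisets\<close>

definition clause_code :: "nat literal list \<Rightarrow> int multiset" where
  "clause_code L = mset (map lit_code (if length L = 1 then L @ L else L))"

lemma lit_code_nonzero [simp]: "lit_code l \<noteq> 0"
  by (cases l) auto

lemma fold_parse_clause:
  assumes "length L \<le> 2"
  shows "fold parse_step (map lit_code L @ [0]) (0, 0, M, bad) =
    (0, 0, if L = [] then M else add_mset (clause_code L) M, bad \<or> L = [])"
proof -
  consider "L = []" | a where "L = [a]" | a b where "L = [a, b]"
    using assms by (cases L rule: list.exhaust; cases "tl L" rule: list.exhaust; cases "tl (tl L)") auto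
  then show ?thesis by cases (auto simp: clause_code_def)
qed

lemma fold_parse:
  assumes "\<forall>L\<in>set Ls. length L \<le> 2"
  shows "fold parse_step (concat (map (\<lambda>L. map lit_code L @ [0]) Ls)) (0, 0, M, bad) =
    (0, 0, mset (map clause_code (filter (\<lambda>L. L \<noteq> []) Ls)) + M, bad \<or> [] \<in> set Ls)"
  using assms
proof (induction Ls arbitrary: M bad)
  case (Cons L Ls)
  have "fold parse_step (concat (map (\<lambda>L. map lit_code L @ [0]) (L # Ls))) (0, 0, M, bad) =
    fold parse_step (concat (map (\<lambda>L. map lit_code L @ [0]) Ls))
      (fold parse_step (map lit_code L @ [0]) (0, 0, M, bad))"
    by simp
  also have "\<dots> = (0, 0, mset (map clause_code (filter (\<lambda>L. L \<noteq> []) (L # Ls))) + M, bad \<or> [] \<in> set (L # Ls))"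
    using Cons by (subst fold_parse_clause) auto
  finally show ?case .
qed simp

lemma set_clause_code: "set_mset (clause_code L) = lit_code ` set L"
  by (auto simp: clause_code_def)

lemma sat_clause_code:
  "sat (mset (map clause_code Ls)) \<longleftrightarrow> satisfiable (set (map set Ls))"
proof
  assume "sat (mset (map clause_code Ls))"
  then obtain \<phi> where \<phi>: "asg \<phi>" "\<forall>L\<in>set Ls. \<exists>l\<in>set L. \<phi> (lit_code l)"
    by (auto simp: sat_def models_def set_clause_code)
  define \<psi> where "\<psi> v = Some (\<phi> (int v + 1))" for v
  have "lit_true \<psi> l \<longleftrightarrow> \<phi> (lit_code l)" for l
    using asg_minus[OF \<phi>(1), of "int v + 1" for v] by (cases l) (simp_all add: \<psi>_def)
  with \<phi>(2) show "satisfiable (set (map set Ls))"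
    by (auto simp: satisfiable_def satisfies_def intro!: exI[of _ \<psi>])
next
  assume "satisfiable (set (map set Ls))"
  then obtain \<psi> where \<psi>: "\<forall>L\<in>set Ls. \<exists>l\<in>set L. lit_true \<psi> l"
    by (auto simp: satisfiable_def satisfies_def)
  \<comment> \<open>Unassigned variables are read as false, which makes the assignment total and
    keeps true literals true.\<close>
  define \<phi> where "\<phi> x = (if x > 0 then \<psi> (nat (x - 1)) = Some True else \<psi> (nat (- x - 1)) \<noteq> Some True)"
    for x :: int
  have "asg \<phi>" by (auto simp: asg_def \<phi>_def)
  moreover have "\<phi> (lit_code l)" if "lit_true \<psi> l" for l
    using that by (cases l) (auto simp: \<phi>_def)
  ultimately show "sat (mset (map clause_code Ls))"
    using \<psi> unfolding sat_def models_def by (fastforce simp: set_clause_code)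
qed

text \<open>Distinct list entries have distinct literal sets, so deleting a clause from the set is
  deleting one entry. Doubling the literal of a unit clause leaves its set of literals unchanged,
  and satisfaction sees nothing else.\<close>

lemma mu_clause_code:
  assumes "distinct (map set Ls)"
  shows "mu (mset (map clause_code Ls)) \<longleftrightarrow> minimally_unsat (set (map set Ls))"
proof -
  have d: "distinct Ls" "inj_on set (set Ls)" using assms by (simp_all add: distinct_map)
  have "sat (mset (map clause_code Ls) - {#clause_code L#}) \<longleftrightarrow> satisfiable (set (map set Ls) - {set L})"
    if "L \<in> set Ls" for L
  proof -
    have "mset (map clause_code Ls) - {#clause_code L#} = mset (map clause_code (remove1 L Ls))"
      using that by (simp add: image_mset_Diff)
    moreover have "set (map set Ls) - {set L} = set (map set (remove1 L Ls))"
      using d that by (auto simp: inj_on_def)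
    ultimately show ?thesis using sat_clause_code by metis
  qed
  then show ?thesis
    unfolding mu_def minimally_unsat_def using sat_clause_code[of Ls] by simp
qed

section \<open>The decision procedure\<close>

definition contract_pass :: com where
  "contract_pass = Seq (Assign 3 (Load 0 (Reg 1)))
    (If (And (Eq (Reg 2) (Const 0)) (And (Not (Eq (Load 1 (Reg 3)) (Const 0))) (Eq (Load 2 (Reg 3)) (Const 0))))
      contract Skip)"

text \<open>\<open>Q\<close> is the verdict on the original input. All literals of the current
  \<open>M\<close> are entries of \<open>w\<close>, so a sweep over \<open>w\<close> reaches each of
  them; the separators 0 have no neighbours and are passed over.\<close>

definition contracted :: "bool \<Rightarrow> int list \<Rightarrow> nat \<Rightarrow> state \<Rightarrow> bool" where
  "contracted Q w i s \<longleftrightarrow> input w i s \<and> regs s 7 = 0 \<and>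
    (if regs s 2 \<noteq> 0 then \<not> Q
     else \<exists>M. stores s (nbs M) \<and> wf2 M \<and> (Q \<longleftrightarrow> mu M) \<and>
       (\<forall>z. nbs M z \<noteq> {#} \<longrightarrow> z \<in> set w) \<and> (\<forall>j<i. deg M (w ! j) \<noteq> 1))"

lemma stores_cong: "arrs s = arrs s' \<Longrightarrow> stores s N \<longleftrightarrow> stores s' N"
  by (simp add: stores_def)

lemma contracted_step:
  assumes "contracted Q w i s" "i < length w"
  shows "contracted Q w (Suc i) (run (Seq contract_pass advance) s)"
proof -
  have inp: "input w i s" and s7: "regs s 7 = 0" using assms(1) by (simp_all add: contracted_def)
  define s1 where "s1 = s\<lparr>regs := (regs s)(3 := w ! i)\<rparr>"
  have s1: "regs s1 2 = regs s 2" "regs s1 7 = 0" "regs s1 3 = w ! i" "arrs s1 = arrs s"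
    using s7 by (simp_all add: s1_def)
  have inp1: "input w i s1" using inp by (simp add: input_def s1_def)
  let ?s' = "run contract_pass s"
  have s': "?s' = (if regs s 2 = 0 \<and> arrs s 1 (w ! i) \<noteq> 0 \<and> arrs s 2 (w ! i) = 0
      then run contract s1 else s1)"
    using input_fetch[OF inp assms(2)] by (simp add: contract_pass_def s1_def)
  have "input w i ?s' \<and> regs ?s' 7 = 0 \<and> (if regs ?s' 2 \<noteq> 0 then \<not> Q
    else (\<exists>M. stores ?s' (nbs M) \<and> wf2 M \<and> (Q \<longleftrightarrow> mu M) \<and>
       (\<forall>z. nbs M z \<noteq> {#} \<longrightarrow> z \<in> set w) \<and> (\<forall>j<Suc i. deg M (w ! j) \<noteq> 1)))"
  proof (cases "regs s 2 = 0")
    case False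
    then show ?thesis using assms(1) s' s1 inp1 by (simp add: contracted_def)
  next
    case True
    then obtain M where M: "stores s (nbs M)" "wf2 M" "Q \<longleftrightarrow> mu M"
      "\<forall>z. nbs M z \<noteq> {#} \<longrightarrow> z \<in> set w" "\<forall>j<i. deg M (w ! j) \<noteq> 1"
      using assms(1) unfolding contracted_def by auto
    have st1: "stores s1 (nbs M)" using M(1) stores_cong s1(4) by blast
    show ?thesis
    proof (cases "deg M (w ! i) = 1")
      case False
      then have "arrs s 1 (w ! i) = 0 \<or> arrs s 2 (w ! i) \<noteq> 0"
        using M(1) unfolding stores_def by (auto split: if_splits)
      then have "?s' = s1" using s' by auto
      moreover have "\<forall>j<Suc i. deg M (w ! j) \<noteq> 1" using False M(5) less_Suc_eq by auto
      ultimately show ?thesis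
        using s1 True inp1 st1 M by auto
    next
      case one: True
      then have "arrs s 1 (w ! i) \<noteq> 0" "arrs s 2 (w ! i) = 0"
        using M(1) unfolding stores_def by (auto split: if_splits)
      then have e: "?s' = run contract s1" using s' True by simp
      have one': "deg M (regs s1 3) = 1" using one s1 by simp
      have flag: "regs s1 2 = 0" using True s1 by simp
      note cc = contract_correct[OF flag st1 M(2) one', folded e]
      have inp': "input w i ?s'" "regs ?s' 7 = 0"
        using input_frame[OF inp1 cc(1)] cc(1) s1 by (simp_all add: frame_def)
      show ?thesis
      proof (cases "regs ?s' 2 = 0")
        case False
        then show ?thesis using cc(2) inp' M(3) by simp
      next
        case True
        from cc(3)[OF True] obtain M' where M': "stores ?s' (nbs M')" "wf2 M'" "mu M \<longleftrightarrow> mu M'"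
          "\<forall>z. nbs M' z \<noteq> {#} \<longrightarrow> nbs M z \<noteq> {#}" "\<forall>z. deg M z \<noteq> 1 \<longrightarrow> deg M' z \<noteq> 1"
          "deg M' (w ! i) \<noteq> 1" using s1(3) by auto
        have "\<forall>j<Suc i. deg M' (w ! j) \<noteq> 1" using M'(5,6) M(5) less_Suc_eq by auto
        moreover have "\<forall>z. nbs M' z \<noteq> {#} \<longrightarrow> z \<in> set w" using M'(4) M(4) by blast
        ultimately show ?thesis using True inp' M(3) M'(1-3) by auto
      qed
    qed
  qed
  moreover have "regs (run advance ?s') 2 = regs ?s' 2" "regs (run advance ?s') 7 = regs ?s' 7"
    and "stores (run advance ?s') N \<longleftrightarrow> stores ?s' N" for N
    by (simp_all add: stores_def)
  ultimately show ?thesis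
    unfolding contracted_def run.simps(4) using input_advance by metis
qed

definition eliminate_pass :: com where
  "eliminate_pass = Seq (Assign 3 (Load 0 (Reg 1)))
    (If (And (Eq (Reg 2) (Const 0)) (Not (Eq (Load 1 (Reg 3)) (Const 0)))) eliminate Skip)"

text \<open>Literals at the positions passed have vanished, so a sweep without rejection ends with
  \<open>M\<close> empty and the verdict in register 7.\<close>

definition eliminated :: "bool \<Rightarrow> int list \<Rightarrow> nat \<Rightarrow> state \<Rightarrow> bool" where
  "eliminated Q w i s \<longleftrightarrow> input w i s \<and>
    (if regs s 2 \<noteq> 0 then \<not> Q
     else \<exists>M. stores s (nbs M) \<and> wf2 M \<and> saturated M \<and>
       (\<forall>z. nbs M z \<noteq> {#} \<longrightarrow> z \<in> set w) \<and> (\<forall>j<i. nbs M (w ! j) = {#}) \<and>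
       (regs s 7 = 0 \<and> (Q \<longleftrightarrow> mu M) \<or> regs s 7 = 1 \<and> (Q \<longleftrightarrow> M = {#})))"

lemma eliminated_step:
  assumes "eliminated Q w i s" "i < length w"
  shows "eliminated Q w (Suc i) (run (Seq eliminate_pass advance) s)"
proof -
  have inp: "input w i s" using assms(1) by (simp add: eliminated_def)
  define s1 where "s1 = s\<lparr>regs := (regs s)(3 := w ! i)\<rparr>"
  have s1: "regs s1 2 = regs s 2" "regs s1 7 = regs s 7" "regs s1 3 = w ! i" "arrs s1 = arrs s"
    by (simp_all add: s1_def)
  have inp1: "input w i s1" using inp by (simp add: input_def s1_def)
  let ?s' = "run eliminate_pass s"
  have s': "?s' = (if regs s 2 = 0 \<and> arrs s 1 (w ! i) \<noteq> 0 then run eliminate s1 else s1)"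
    using input_fetch[OF inp assms(2)] by (simp add: eliminate_pass_def s1_def)
  have "input w i ?s' \<and> (if regs ?s' 2 \<noteq> 0 then \<not> Q
    else \<exists>M. stores ?s' (nbs M) \<and> wf2 M \<and> saturated M \<and>
       (\<forall>z. nbs M z \<noteq> {#} \<longrightarrow> z \<in> set w) \<and> (\<forall>j<Suc i. nbs M (w ! j) = {#}) \<and>
       (regs ?s' 7 = 0 \<and> (Q \<longleftrightarrow> mu M) \<or> regs ?s' 7 = 1 \<and> (Q \<longleftrightarrow> M = {#})))"
  proof (cases "regs s 2 = 0")
    case False
    then show ?thesis using assms(1) s' s1 inp1 by (simp add: eliminated_def)
  next
    case True
    then obtain M where M: "stores s (nbs M)" "wf2 M" "saturated M"
      "\<forall>z. nbs M z \<noteq> {#} \<longrightarrow> z \<in> set w" "\<forall>j<i. nbs M (w ! j) = {#}"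
      "regs s 7 = 0 \<and> (Q \<longleftrightarrow> mu M) \<or> regs s 7 = 1 \<and> (Q \<longleftrightarrow> M = {#})"
      using assms(1) unfolding eliminated_def by auto
    have st1: "stores s1 (nbs M)" using M(1) stores_cong s1(4) by blast
    show ?thesis
    proof (cases "nbs M (w ! i) = {#}")
      case dead: True
      then have "?s' = s1" using s' stores_first[OF M(1)] by simp
      moreover have "\<forall>j<Suc i. nbs M (w ! j) = {#}" using dead M(5) less_Suc_eq by auto
      ultimately show ?thesis
        using s1 True inp1 st1 M by auto
    next
      case alive: False
      then have e: "?s' = run eliminate s1" using s' True stores_first[OF M(1)] by simp
      show ?thesis
      proof (cases "regs s 7 = 0")
        case False
        then have "?s' = s1\<lparr>regs := (regs s1)(2 := 1)\<rparr>" using e s1 by (simp add: eliminate_def)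
        \<comment> \<open>A literal that still occurs contradicts the emptiness demanded by register
          7.\<close>
        moreover have "\<not> Q" using False M(6) alive by auto
        ultimately show ?thesis using inp1 by (simp add: input_def)
      next
        case ans: True
        have "nbs M (regs s1 3) \<noteq> {#}" "regs s1 2 = 0" "regs s1 7 = 0"
          using alive s1 ans True by simp_all
        note ec = eliminate_correct[OF this(2) st1 M(2,3) this(1,3), folded e]
        have inp': "input w i ?s'" using input_frame[OF inp1 conjunct1[OF ec]] by simp
        have Q: "Q \<longleftrightarrow> mu M" using M(6) ans by simp
        show ?thesis
        proof (cases "regs ?s' 2 = 0")
          case False
          then show ?thesis using ec inp' Q by simp
        next
          case True
          with ec obtain M' where M': "stores ?s' (nbs M')" "wf2 M'" "saturated M'"
            "\<forall>z. nbs M' z \<noteq> {#} \<longrightarrow> nbs M z \<noteq> {#}" "nbs M' (w ! i) = {#}"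
            "regs ?s' 7 = 0 \<and> (mu M \<longleftrightarrow> mu M') \<or> regs ?s' 7 = 1 \<and> (mu M \<longleftrightarrow> M' = {#})"
            using s1(3) by auto
          have "\<forall>j<Suc i. nbs M' (w ! j) = {#}" using M'(4,5) M(5) less_Suc_eq by metis
          moreover have "\<forall>z. nbs M' z \<noteq> {#} \<longrightarrow> z \<in> set w" using M'(4) M(4) by blast
          ultimately show ?thesis using True inp' M'(1,2,3,6) Q by auto
        qed
      qed
    qed
  qed
  moreover have "regs (run advance ?s') 2 = regs ?s' 2" "regs (run advance ?s') 7 = regs ?s' 7"
    and "stores (run advance ?s') N \<longleftrightarrow> stores ?s' N" for N
    by (simp_all add: stores_def)
  ultimately show ?thesis
    unfolding eliminated_def run.simps(4) using input_advance by metis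
qed

text \<open>The test on register 0 singles out the word \<open>[0]\<close> of the clause-set with
  only the empty clause, the one minimally unsatisfiable input on which \<open>parse\<close> raises
  register 2.\<close>

definition decide_mu :: com where
  "decide_mu = Seq (for_each parse) (Seq (Assign 1 (Const 0)) (Seq (for_each contract_pass)
    (Seq (Assign 1 (Const 0)) (Seq (for_each eliminate_pass)
    (If (Eq (Reg 0) (Const 1)) (Assign 0 (Const 1))
    (If (Eq (Reg 2) (Const 0)) (Assign 0 (Reg 7)) (Assign 0 (Const 0))))))))"

lemma loop_free_passes: "loop_free parse" "loop_free contract_pass" "loop_free eliminate_pass"
  by (simp_all add: parse_def contract_pass_def contract_def eliminate_pass_def eliminate_def
      checked_relink_def relink_def)

lemma exec_decide_mu:
  assumes "parsed w 0 s0"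
    and restart1: "\<And>s. parsed w (length w) s \<Longrightarrow> contracted Q w 0 (run (Assign 1 (Const 0)) s)"
  shows "\<exists>t s. exec decide_mu s0 t s \<and>
    t \<le> (max_steps parse + max_steps contract_pass + max_steps eliminate_pass + 40) * (length w + 1) \<and>
    regs s 0 = (if length w = 1 \<or> Q then 1 else 0)"
proof -
  let ?n = "length w"
  have regs: "regs s 0 = int ?n \<and> regs s 1 = int i"
    if "parsed w i s \<or> contracted Q w i s \<or> eliminated Q w i s" for i s
    using that by (auto simp: parsed_def contracted_def eliminated_def input_def)
  obtain t1 s1 where 1: "exec (for_each parse) s0 t1 s1" "parsed w ?n s1"
    "t1 \<le> (max_steps parse + 7) * (?n + 1)"
    using exec_for_each[of parse "parsed w", OF loop_free_passes(1) parsed_step regs assms(1)] by blast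
  let ?s1 = "run (Assign 1 (Const 0)) s1"
  have 2: "exec (Assign 1 (Const 0)) s1 2 ?s1" using exec.Assign[of 1 "Const 0" s1] by (simp add: numeral_2_eq_2)
  obtain t3 s3 where 3: "exec (for_each contract_pass) ?s1 t3 s3" "contracted Q w ?n s3"
    "t3 \<le> (max_steps contract_pass + 7) * (?n + 1)"
    using exec_for_each[of contract_pass "contracted Q w",
        OF loop_free_passes(2) contracted_step regs restart1[OF 1(2)]] by blast
  let ?s3 = "run (Assign 1 (Const 0)) s3"
  have 4: "exec (Assign 1 (Const 0)) s3 2 ?s3" using exec.Assign[of 1 "Const 0" s3] by (simp add: numeral_2_eq_2)
  have 50: "eliminated Q w 0 ?s3"
  proof -
    have "input w 0 ?s3" using 3(2) by (simp add: contracted_def input_def)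
    moreover have "stores ?s3 N \<longleftrightarrow> stores s3 N" for N by (rule stores_cong) simp
    moreover have "saturated M" if M: "stores s3 (nbs M)" "\<forall>z. nbs M z \<noteq> {#} \<longrightarrow> z \<in> set w"
      "\<forall>j<?n. deg M (w ! j) \<noteq> 1" for M
      unfolding saturated_def
    proof (intro allI impI)
      fix z assume z: "nbs M z \<noteq> {#}"
      then obtain j where "j < ?n" "z = w ! j" using M(2) by (metis in_set_conv_nth)
      then have "deg M z \<noteq> 1" using M(3) by simp
      moreover have "deg M z \<le> 2" using stores_deg_le[OF M(1)] .
      moreover have "deg M z \<noteq> 0" using z by (simp only: size_eq_0_iff_empty not_False_eq_True)
      ultimately show "deg M z = 2" by linarith
    qed
    moreover have "regs ?s3 2 = regs s3 2" "regs ?s3 7 = regs s3 7" by simp_all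
    ultimately show ?thesis
      using 3(2) unfolding contracted_def eliminated_def by (metis not_less_zero)
  qed
  obtain t5 s5 where 5: "exec (for_each eliminate_pass) ?s3 t5 s5" "eliminated Q w ?n s5"
    "t5 \<le> (max_steps eliminate_pass + 7) * (?n + 1)"
    using exec_for_each[of eliminate_pass "eliminated Q w",
        OF loop_free_passes(3) eliminated_step regs 50] by blast
  let ?last = "If (Eq (Reg 0) (Const 1)) (Assign 0 (Const 1))
    (If (Eq (Reg 2) (Const 0)) (Assign 0 (Reg 7)) (Assign 0 (Const 0)))"
  obtain t6 where 6: "t6 \<le> max_steps ?last" "exec ?last s5 t6 (run ?last s5)"
    using exec_run[of ?last s5] by auto
  have "exec decide_mu s0 (t1 + (2 + (t3 + (2 + (t5 + t6))))) (run ?last s5)"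
    unfolding decide_mu_def by (intro exec.Seq[OF 1(1)] exec.Seq[OF 2] exec.Seq[OF 3(1)] exec.Seq[OF 4] exec.Seq[OF 5(1)] 6(2))
  moreover have "t1 + (2 + (t3 + (2 + (t5 + t6)))) \<le>
    (max_steps parse + max_steps contract_pass + max_steps eliminate_pass + 40) * (?n + 1)"
  proof -
    \<comment> \<open>The 40 is three times the 7 of a loop plus 19 for the two resets of register
      1, two steps each, and the final test.\<close>
    have "t6 \<le> 15" using 6(1) by simp
    then have "2 + 2 + t6 \<le> 19 * (?n + 1)" by simp
    then show ?thesis using 1(3) 3(3) 5(3) by (simp add: algebra_simps)
  qed
  moreover have "regs (run ?last s5) 0 = (if length w = 1 \<or> Q then 1 else 0)"
  proof (cases "regs s5 2 = 0")
    case True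
    then obtain M where M: "wf2 M" "\<forall>z. nbs M z \<noteq> {#} \<longrightarrow> z \<in> set w" "\<forall>j<?n. nbs M (w ! j) = {#}"
      "regs s5 7 = 0 \<and> (Q \<longleftrightarrow> mu M) \<or> regs s5 7 = 1 \<and> (Q \<longleftrightarrow> M = {#})"
      using 5(2) unfolding eliminated_def by auto
    have "nbs M z = {#}" for z using M(2,3) by (metis in_set_conv_nth)
    then have "M = {#}" using M(1) nbs_eq_empty_iff[OF M(1)]
      by (metis multiset_cases union_single_eq_member wf2_def)
    \<comment> \<open>With \<open>M\<close> empty, register 7 at 0 makes \<open>Q\<close> equivalent
      to \<open>mu {#}\<close>, hence false; at 1 it makes \<open>Q\<close> true.\<close>
    moreover have "\<not> mu {#}" using sat_empty by (simp add: mu_def)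
    ultimately show ?thesis using M(4) True 5(2) by (auto simp: eliminated_def input_def)
  next
    case False
    then show ?thesis using 5(2) by (auto simp: eliminated_def input_def)
  qed
  ultimately show ?thesis by blast
qed

theorem theorem4p5:
  "decidable_in_linear_time encodes
     {F :: nat clause set. clause_set F \<and> (\<forall>C\<in>F. card C \<le> 2)} minimally_unsat"
  unfolding decidable_in_linear_time_def
proof (rule exI[of _ decide_mu],
    rule exI[of _ "max_steps parse + max_steps contract_pass + max_steps eliminate_pass + 40"],
    intro ballI allI impI)
  fix F :: "nat clause set" and w
  assume "F \<in> {F. clause_set F \<and> (\<forall>C\<in>F. card C \<le> 2)}" and "encodes F w"
  then obtain Ls where Ls: "distinct (map set Ls)" "\<forall>L\<in>set Ls. distinct L" "F = set (map set Ls)"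
    and w: "w = concat (map (\<lambda>L. map lit_code L @ [0]) Ls)" and card: "\<forall>C\<in>F. card C \<le> 2"
    unfolding encodes_def by blast
  have len: "\<forall>L\<in>set Ls. length L \<le> 2" using Ls card by (auto simp: distinct_card)
  \<comment> \<open>A word of length one is decided by its own test and is kept out of the verdict
    of the sweeps.\<close>
  define Q where "Q \<longleftrightarrow> minimally_unsat F \<and> length w \<noteq> 1"
  have single: "minimally_unsat F" if 1: "length w = 1"
  proof -
    obtain L Ls' where L: "Ls = L # Ls'" using 1 w by (cases Ls) auto
    then have "Ls = [[]]" using 1 w by (cases Ls') auto
    then show ?thesis using Ls(3) by (auto simp: minimally_unsat_def satisfiable_def satisfies_def)
  qed
  \<comment> \<open>An empty clause is unsatisfiable alone, so any second clause destroys
    minimality; without one the word has length one.\<close>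
  have bad: "\<not> Q" if "[] \<in> set Ls"
  proof
    assume "Q"
    have "F \<noteq> {{}}"
    proof
      assume "F = {{}}"
      then have "set ` set Ls = {{}}" using Ls(3) by simp
      moreover have "length Ls = card F" using Ls(1,3) distinct_card by (metis length_map)
      ultimately have "Ls = [[]]" using \<open>F = {{}}\<close> that by (cases Ls) auto
      then show False using \<open>Q\<close> w by (simp add: Q_def)
    qed
    moreover have "{} \<in> F" using that Ls(3) by force
    ultimately obtain C where "C \<in> F" "C \<noteq> {}" by blast
    then have "satisfiable (F - {C})" using \<open>Q\<close> by (simp add: Q_def minimally_unsat_def)
    then show False using \<open>{} \<in> F\<close> \<open>C \<noteq> {}\<close> by (auto simp: satisfiable_def satisfies_def)
  qed
  \<comment> \<open>Arrays filled with zeros store the multigraph without clauses, so no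
    initialisation has to be paid for.\<close>
  have start: "parsed w 0 (init_state w)"
    by (auto simp: parsed_def input_def init_state_def holds_def stores_def)
  have restart: "contracted Q w 0 (run (Assign 1 (Const 0)) s)" if "parsed w (length w) s" for s
  proof -
    let ?s = "run (Assign 1 (Const 0)) s" and ?M = "mset (map clause_code (filter (\<lambda>L. L \<noteq> []) Ls))"
    have "fold parse_step w (0, 0, {#}, False) = (0, 0, ?M, [] \<in> set Ls)"
      using fold_parse[OF len, of "{#}" False] by (simp add: w)
    then have h: "if [] \<in> set Ls then regs s 2 \<noteq> 0 else holds s (nbs ?M)" and wf: "wf2 ?M"
      and inp: "input w (length w) s" "regs s 7 = 0"
      using that unfolding parsed_def by auto
    have base: "input w 0 ?s" "regs ?s 7 = 0" using inp by (simp_all add: input_def)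
    show ?thesis
    proof (cases "[] \<in> set Ls")
      case True
      then show ?thesis using base h bad by (simp add: contracted_def)
    next
      case False
      then have "filter (\<lambda>L. L \<noteq> []) Ls = Ls" by (intro filter_True) auto
      then have M: "?M = mset (map clause_code Ls)" by (simp only:)
      have "length w \<noteq> 1" using False w
        by (cases Ls; cases "tl Ls") (auto simp: Suc_eq_plus1[symmetric])
      then have Q: "Q \<longleftrightarrow> mu ?M"
        unfolding M Q_def mu_clause_code[OF Ls(1)] Ls(3) by simp
      have h: "holds s (nbs ?M)" using h False by simp
      have "z \<in> set w" if z: "nbs ?M z \<noteq> {#}" for z
      proof -
        obtain L where "L \<in> set Ls" "z \<in># clause_code L"
          using z nbs_eq_empty_iff[OF wf] by auto
        then show ?thesis by (auto simp: w set_clause_code)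
      qed
      moreover have "stores ?s N \<longleftrightarrow> stores s N" for N by (rule stores_cong) simp
      ultimately show ?thesis
        using base h Q wf holds_rejected[OF h _ wf] unfolding contracted_def holds_def by auto
    qed
  qed
  have "length w = 1 \<or> Q \<longleftrightarrow> minimally_unsat F" using single by (auto simp: Q_def)
  then show "\<exists>t s. exec decide_mu (init_state w) t s \<and>
      t \<le> (max_steps parse + max_steps contract_pass + max_steps eliminate_pass + 40) * (length w + 1) \<and>
      regs s 0 = (if minimally_unsat F then 1 else 0)"
    using exec_decide_mu[OF start restart] by simp
qed

end
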